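(* In the Bayesian $k$-armed bandit problem described in the context, suppose the prior $\Gamma$ is $1$-regular with constants $0<c_0<C_0$ and every $P_\mu$ is $1$-subgaussian, and the Greedy algorithm is executed. Then for $k\ge(54e\log T)/c_0$, $$BR_{T,k}(\mathrm{Greedy})\le1+3T\Bigl[\frac{2e\log T}{kc_0}\Bigr]^{1/3}+\frac{C_0k}{C_1}\bigl(15+\log(kc_0/2e)-\log\log T\bigr),$$ where $C_1=(1-e^{-1})/2$. Furthermore, the Bayesian regret of SS-Greedy executed with $m=\Theta(T^{3/4})$ is $\tilde O(T^{3/4})$.
   Context: Bayesian $k$-armed bandit: horizon $T$, arms $[k]$, family $\{P_\mu:\mu\in[0,1]\}$ with $P_\mu$ of mean $\mu$; prior $\Gamma$ on $[0,1]$ with density; means i.i.d. $\sim\Gamma$; pulling arm $i$ at time $t$ gives $Y_{it}\sim P_{\mu_i}$ independently, only the pulled reward observed. $R_T(\pi\mid\bm\mu)=T\max_i\mu_i-\sum_t\mathbb{E}[\mu_{a_t}\mid\pi]$, $BR_{T,k}(\pi)=\mathbb{E}[R_T(\pi\mid\bm\mu)]$. $1$-regular: $c_0\epsilon\le\mathbb{P}_\Gamma(\mu>1-\epsilon)\le\mathbb{P}_\Gamma(\mu\ge1-\epsilon)\le C_0\epsilon$ for $\epsilon\in(0,1]$. $1$-subgaussian: $\mathbb{E}[e^{s(Z-\mu)}]\le e^{s^2/2}$ for $Z\sim P_\mu$. Greedy: pull each arm once, then always the arm with largest empirical mean. SS-Greedy($m$): run Greedy on $m$ arms drawn uniformly without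 replacement from $[k]$. $\tilde O$ hides polylog factors and constants. *)

theory Defs
  imports "HOL-Probability.Probability" "HOL-Library.Landau_Symbols"
begin

text \<open>Arms are indexed 0..k-1, time steps 0..T-1.  The reward table Y maps (i,t)
  to Y_{it}, the reward obtained if arm i is pulled at time t.\<close>

definition emp_mean :: "(nat \<times> nat \<Rightarrow> real) \<Rightarrow> nat list \<Rightarrow> nat \<Rightarrow> real" where
  "emp_mean Y h i =
     (\<Sum>s\<in>{s. s < length h \<and> h ! s = i}. Y (i, s)) / real (card {s. s < length h \<and> h ! s = i})"

definition greedy_next :: "nat list \<Rightarrow> (nat \<times> nat \<Rightarrow> real) \<Rightarrow> nat list \<Rightarrow> nat" where
  "greedy_next arms Y h =
     (if length h < length arms then arms ! length h
      else hd (filter (\<lambda>i. \<forall>j\<in>set arms. emp_mean Y h j \<le> emp_mean Y h i) arms))"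

primrec greedy_hist :: "nat list \<Rightarrow> (nat \<times> nat \<Rightarrow> real) \<Rightarrow> nat \<Rightarrow> nat list" where
  "greedy_hist arms Y 0 = []"
| "greedy_hist arms Y (Suc t) = greedy_hist arms Y t @ [greedy_next arms Y (greedy_hist arms Y t)]"

definition greedy :: "nat list \<Rightarrow> (nat \<times> nat \<Rightarrow> real) \<Rightarrow> nat \<Rightarrow> nat" where
  "greedy arms Y t = greedy_next arms Y (greedy_hist arms Y t)"

definition reward_space :: "(real \<Rightarrow> real measure) \<Rightarrow> nat \<Rightarrow> nat \<Rightarrow> (nat \<Rightarrow> real)
    \<Rightarrow> (nat \<times> nat \<Rightarrow> real) measure" where
  "reward_space P k T \<mu> = PiM ({..<k} \<times> {..<T}) (\<lambda>(i, t). P (\<mu> i))"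

definition regret :: "(real \<Rightarrow> real measure) \<Rightarrow> nat \<Rightarrow> nat
    \<Rightarrow> ((nat \<times> nat \<Rightarrow> real) \<Rightarrow> nat \<Rightarrow> nat) \<Rightarrow> (nat \<Rightarrow> real) \<Rightarrow> real" where
  "regret P k T \<pi> \<mu> =
     real T * Max (\<mu> ` {..<k}) - (\<Sum>t<T. \<integral>Y. \<mu> (\<pi> Y t) \<partial>reward_space P k T \<mu>)"

definition bayes_regret :: "real measure \<Rightarrow> (real \<Rightarrow> real measure) \<Rightarrow> nat \<Rightarrow> nat
    \<Rightarrow> ((nat \<times> nat \<Rightarrow> real) \<Rightarrow> nat \<Rightarrow> nat) \<Rightarrow> real" where
  "bayes_regret \<Gamma> P k T \<pi> = (\<integral>\<mu>. regret P k T \<pi> \<mu> \<partial>PiM {..<k} (\<lambda>_. \<Gamma>))"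

definition ss_greedy_bayes_regret :: "real measure \<Rightarrow> (real \<Rightarrow> real measure) \<Rightarrow> nat \<Rightarrow> nat
    \<Rightarrow> nat \<Rightarrow> real" where
  "ss_greedy_bayes_regret \<Gamma> P k T m =
     measure_pmf.expectation (pmf_of_set {S. S \<subseteq> {..<k} \<and> card S = m})
       (\<lambda>S. bayes_regret \<Gamma> P k T (greedy (sorted_list_of_set S)))"

definition one_regular :: "real measure \<Rightarrow> real \<Rightarrow> real \<Rightarrow> bool" where
  "one_regular \<Gamma> c0 C0 \<longleftrightarrow>
     (\<forall>\<epsilon>. 0 < \<epsilon> \<and> \<epsilon> \<le> 1 \<longrightarrow>
        c0 * \<epsilon> \<le> measure \<Gamma> {\<mu>. \<mu> > 1 - \<epsilon>}
      \<and> measure \<Gamma> {\<mu>. \<mu> > 1 - \<epsilon>} \<le> measure \<Gamma> {\<mu>. \<mu> \<ge> 1 - \<epsilon>}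
      \<and> measure \<Gamma> {\<mu>. \<mu> \<ge> 1 - \<epsilon>} \<le> C0 * \<epsilon>)"

definition one_subgaussian :: "real measure \<Rightarrow> real \<Rightarrow> bool" where
  "one_subgaussian Q \<mu> \<longleftrightarrow>
     (\<forall>s::real. integrable Q (\<lambda>z. exp (s * (z - \<mu>))) \<and>
        (\<integral>z. exp (s * (z - \<mu>)) \<partial>Q) \<le> exp (s\<^sup>2 / 2))"

end

theory Submission
  imports Defs "HOL-Real_Asymp.Real_Asymp"
begin

text \<open>
For predictable coefficients \<open>c\<^sub>t\<close> the process
\<open>exp (\<Sum>t. c\<^sub>t (Y\<^sub>t - \<mu>\<^sub>t) - c\<^sub>t\<^sup>2 / 2)\<close> along the pulled rewards is a supermartingale, and two
choices of \<open>c\<close> suffice.  Put \<open>\<theta> = 1 - 2\<delta>\<close>.  With \<open>c = -\<delta>\<close> on the arms of mean above \<open>1 - \<delta>\<close>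
until their empirical mean first falls below \<open>\<theta>\<close>, Markov's inequality shows that all \<open>g\<close> such arms
fall below \<open>\<theta>\<close> with probability at most \<open>exp (-g \<delta>\<^sup>2 / 2)\<close>; no independence between the arms is
needed.  Otherwise greedy only ever exploits arms whose empirical mean exceeds \<open>\<theta>\<close>.  With
\<open>c = d = \<theta> - \<mu>\<^sub>j\<close> on the first \<open>n\<close> pulls of an arm with \<open>\<mu>\<^sub>j < 1 - 3\<delta>\<close>, its \<open>n\<close>-th empirical mean
exceeds \<open>\<theta>\<close> with probability at most \<open>exp (-n d\<^sup>2 / 2)\<close>, so it is pulled at most \<open>1 / (C\<^sub>1 d\<^sup>2)\<close> times
in expectation.  Averaging over the prior and taking \<open>\<delta>\<^sup>3 = 2 e log T / (k c\<^sub>0)\<close> gives the bound; it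
uses only that the best mean is at most 1, hence applies to every subsample of the arms.
\<close>


subsection \<open>Exponential supermartingales for adaptively sampled rewards\<close>

text \<open>The moment bound is stated with the nonnegative integral, so that the supermartingale
  induction carries no integrability obligations. All indices \<open>i\<close> are covered, so that
  no range conditions on arms arise; \<open>regret_le\<close> pads the means accordingly.\<close>

locale subgaussian_table =
  fixes M :: "nat \<Rightarrow> real measure" and \<mu> :: "nat \<Rightarrow> real"
  assumes prob_M: "\<And>i. prob_space (M i)"
    and sets_M: "\<And>i. sets (M i) = sets borel"
    and mgf_M: "\<And>i s. (\<integral>\<^sup>+z. ennreal (exp (s * (z - \<mu> i))) \<partial>M i) \<le> ennreal (exp (s\<^sup>2 / 2))"
begin

definition table :: "nat \<Rightarrow> nat \<Rightarrow> (nat \<times> nat \<Rightarrow> real) measure" where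
  "table k n = PiM ({..<k} \<times> {..<n}) (\<lambda>(i, t). M i)"

lemma product_prob_table: "product_prob_space (\<lambda>(i :: nat, t :: nat). M i)"
  by (intro product_prob_spaceI) (auto simp: prob_M)

lemma prob_space_table: "prob_space (table k n)"
  unfolding table_def by (intro prob_space_PiM) (auto simp: prob_M)

text \<open>Outside the index rectangle every table in the space takes the value
  \<open>undefined\<close>, so the coordinate is constant there and no condition on \<open>p\<close>
  is needed.\<close>

lemma measurable_entry [measurable]: "(\<lambda>Y. Y p) \<in> borel_measurable (table k n)"
proof (cases "p \<in> {..<k} \<times> {..<n}")
  case True
  then have "(\<lambda>Y. Y p) \<in> measurable (table k n) (case p of (i, t) \<Rightarrow> M i)"
    unfolding table_def by (rule measurable_component_singleton)
  then show ?thesis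
    using sets_M by (simp add: split_beta cong: measurable_cong_sets)
next
  case False
  have "(\<lambda>Y. Y p) \<in> borel_measurable (table k n) \<longleftrightarrow> (\<lambda>Y. undefined :: real) \<in> borel_measurable (table k n)"
    by (rule measurable_cong) (use False in \<open>cases p, auto simp: table_def space_PiM PiE_def extensional_def\<close>)
  then show ?thesis by simp
qed

text \<open>\<open>a\<close> is the arm pulled and \<open>c\<close> the coefficient placed on its
  centred reward. The reward at time \<open>t\<close> is read from column \<open>t\<close>, hence is
  fresh at every step even if an arm is pulled repeatedly.\<close>

definition exp_process ::
    "(nat \<Rightarrow> (nat \<times> nat \<Rightarrow> real) \<Rightarrow> nat) \<Rightarrow> (nat \<Rightarrow> (nat \<times> nat \<Rightarrow> real) \<Rightarrow> real)
      \<Rightarrow> nat \<Rightarrow> (nat \<times> nat \<Rightarrow> real) \<Rightarrow> real" where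
  "exp_process a c n Y = exp (\<Sum>t<n. c t Y * (Y (a t Y, t) - \<mu> (a t Y)) - (c t Y)\<^sup>2 / 2)"

lemma measurable_exp_process:
  assumes a_meas [measurable]: "\<And>t n. a t \<in> measurable (table k n) (count_space UNIV)"
    and c_meas [measurable]: "\<And>t n. c t \<in> borel_measurable (table k n)"
  shows "exp_process a c m \<in> borel_measurable (table k n)"
proof -
  have [measurable]: "(\<lambda>Y. Y (a t Y, s)) \<in> borel_measurable (table k n)" for t s
    by (rule measurable_compose_countable[OF _ a_meas]) measurable
  have [measurable]: "(\<lambda>Y. \<mu> (a t Y)) \<in> borel_measurable (table k n)" for t
    by (rule measurable_compose[OF a_meas]) simp
  show ?thesis unfolding exp_process_def by measurable
qed

text \<open>Induction on the horizon replaces conditioning: one more step appends a column of fresh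
  rewards, and Fubini integrates that column first. Predictability freezes \<open>a n\<close> and
  \<open>c n\<close> given the earlier columns, so the inner integral is a single moment generating
  function, whose bound cancels the compensator \<open>exp (- (c n x)\<^sup>2 / 2)\<close>.\<close>

lemma exp_process_supermartingale:
  assumes a_meas: "\<And>t n. a t \<in> measurable (table k n) (count_space UNIV)"
    and c_meas: "\<And>t n. c t \<in> borel_measurable (table k n)"
    and a_less: "\<And>t Y. a t Y < k"
    and predictable: "\<And>t Y Y'. (\<And>i s. i < k \<Longrightarrow> s < t \<Longrightarrow> Y (i, s) = Y' (i, s))
                        \<Longrightarrow> a t Y = a t Y' \<and> c t Y = c t Y'"
  shows "(\<integral>\<^sup>+Y. ennreal (exp_process a c n Y) \<partial>table k n) \<le> 1"
proof (induction n)
  case 0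
  interpret prob_space "table k 0" by (rule prob_space_table)
  show ?case by (simp add: exp_process_def emeasure_space_1)
next
  case (Suc n)
  interpret product_prob_space "\<lambda>(i :: nat, t :: nat). M i" by (rule product_prob_table)
  let ?I = "{..<k} \<times> {..<n}" and ?J = "{..<k} \<times> {n}"
  let ?M = "\<lambda>(i :: nat, t :: nat). M i"
  have IJ: "{..<k} \<times> {..<Suc n} = ?I \<union> ?J" by (auto simp: less_Suc_eq)
  have meas: "(\<lambda>Y. ennreal (exp_process a c m Y)) \<in> borel_measurable (table k m')" for m m'
    using measurable_exp_process[OF a_meas c_meas] by measurable
  have step: "(\<integral>\<^sup>+y. ennreal (exp_process a c (Suc n) (merge ?I ?J (x, y))) \<partial>PiM ?J ?M)
                \<le> ennreal (exp_process a c n x)" for x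
  proof -
    let ?m = "\<lambda>y. merge ?I ?J (x, y)"
    \<comment> \<open>Columns before \<open>n\<close> of the merged table come from \<open>x\<close>
      alone, so the decisions up to and including time \<open>n\<close> do not see
      \<open>y\<close>.\<close>
    have eq: "a t (?m y) = a t x \<and> c t (?m y) = c t x" if "t \<le> n" for t y
      by (rule predictable) (use that in \<open>auto simp: merge_def\<close>)
    have ent: "?m y (a t x, t) = x (a t x, t)" if "t < n" for t y
      using that a_less by (auto simp: merge_def)
    have ent': "?m y (a n x, n) = y (a n x, n)" for y
      using a_less by (auto simp: merge_def)
    have coord: "(\<lambda>y. y (a n x, n)) \<in> measurable (PiM ?J ?M) (?M (a n x, n))"
      by (rule measurable_component_singleton) (use a_less in auto)
    have "exp_process a c (Suc n) (?m y)
        = exp_process a c n x * exp (- (c n x)\<^sup>2 / 2) * exp (c n x * (y (a n x, n) - \<mu> (a n x)))" for y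
      by (simp add: exp_process_def eq ent ent' flip: exp_add)
    then have "(\<integral>\<^sup>+y. ennreal (exp_process a c (Suc n) (?m y)) \<partial>PiM ?J ?M)
       = (\<integral>\<^sup>+y. ennreal (exp_process a c n x * exp (- (c n x)\<^sup>2 / 2))
            * ennreal (exp (c n x * (y (a n x, n) - \<mu> (a n x)))) \<partial>PiM ?J ?M)"
      by (simp add: ennreal_mult exp_process_def)
    also have "\<dots> = ennreal (exp_process a c n x * exp (- (c n x)\<^sup>2 / 2))
        * (\<integral>\<^sup>+y. ennreal (exp (c n x * (y (a n x, n) - \<mu> (a n x)))) \<partial>PiM ?J ?M)"
    proof (rule nn_integral_cmult)
      have "(\<lambda>y. y (a n x, n)) \<in> borel_measurable (PiM ?J ?M)"
        using coord sets_M by (simp cong: measurable_cong_sets)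
      then show "(\<lambda>y. ennreal (exp (c n x * (y (a n x, n) - \<mu> (a n x))))) \<in> borel_measurable (PiM ?J ?M)"
        by measurable
    qed
    \<comment> \<open>Only one coordinate of the new column enters, so its integral reduces to the
      marginal of the pulled arm.\<close>
    also have "(\<integral>\<^sup>+y. ennreal (exp (c n x * (y (a n x, n) - \<mu> (a n x)))) \<partial>PiM ?J ?M)
        = (\<integral>\<^sup>+z. ennreal (exp (c n x * (z - \<mu> (a n x)))) \<partial>distr (PiM ?J ?M) (?M (a n x, n)) (\<lambda>y. y (a n x, n)))"
      by (rule nn_integral_distr[OF coord, symmetric]) (simp add: measurable_cong_sets[OF sets_M refl])
    also have "distr (PiM ?J ?M) (?M (a n x, n)) (\<lambda>y. y (a n x, n)) = ?M (a n x, n)"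
      using a_less distr_PiM_component[of ?J ?M "(a n x, n)"] prob_M by auto
    also have "ennreal (exp_process a c n x * exp (- (c n x)\<^sup>2 / 2))
          * (\<integral>\<^sup>+z. ennreal (exp (c n x * (z - \<mu> (a n x)))) \<partial>?M (a n x, n))
        \<le> ennreal (exp_process a c n x * exp (- (c n x)\<^sup>2 / 2)) * ennreal (exp ((c n x)\<^sup>2 / 2))"
      using mgf_M by (intro mult_left_mono) auto
    also have "\<dots> = ennreal (exp_process a c n x)"
      by (simp add: exp_process_def flip: ennreal_mult exp_add)
    finally show ?thesis .
  qed
  have "(\<integral>\<^sup>+Y. ennreal (exp_process a c (Suc n) Y) \<partial>table k (Suc n))
     = (\<integral>\<^sup>+x. \<integral>\<^sup>+y. ennreal (exp_process a c (Suc n) (merge ?I ?J (x, y))) \<partial>PiM ?J ?M \<partial>PiM ?I ?M)"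
    unfolding table_def IJ
    by (rule product_nn_integral_fold)
      (use meas[of "Suc n" "Suc n"] in \<open>auto simp: table_def IJ\<close>)
  also have "\<dots> \<le> (\<integral>\<^sup>+x. ennreal (exp_process a c n x) \<partial>PiM ?I ?M)"
    by (intro nn_integral_mono step)
  also have "\<dots> \<le> 1"
    using Suc by (simp add: table_def)
  finally show ?case .
qed

lemma exp_process_expectation:
  assumes a_meas: "\<And>t n. a t \<in> measurable (table k n) (count_space UNIV)"
    and c_meas: "\<And>t n. c t \<in> borel_measurable (table k n)"
    and a_less: "\<And>t Y. a t Y < k"
    and predictable: "\<And>t Y Y'. (\<And>i s. i < k \<Longrightarrow> s < t \<Longrightarrow> Y (i, s) = Y' (i, s))
                        \<Longrightarrow> a t Y = a t Y' \<and> c t Y = c t Y'"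
  shows "integrable (table k n) (exp_process a c n) \<and> (\<integral>Y. exp_process a c n Y \<partial>table k n) \<le> 1"
proof -
  have le: "(\<integral>\<^sup>+Y. ennreal (exp_process a c n Y) \<partial>table k n) \<le> 1"
    using assms by (rule exp_process_supermartingale)
  have int: "integrable (table k n) (exp_process a c n)"
    using le measurable_exp_process[OF a_meas c_meas]
    by (intro integrableI_nonneg) (auto simp: exp_process_def intro: order.strict_trans1)
  moreover have "ennreal (\<integral>Y. exp_process a c n Y \<partial>table k n) \<le> 1"
    using le by (subst nn_integral_eq_integral[OF int, symmetric]) (auto simp: exp_process_def)
  ultimately show ?thesis by simp
qed

end


subsection \<open>Histories of the greedy algorithm\<close>

lemma length_greedy_hist [simp]: "length (greedy_hist arms Y t) = t"
  by (induction t) auto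

lemma nth_greedy_hist: "s < t \<Longrightarrow> greedy_hist arms Y t ! s = greedy arms Y s"
  by (induction t) (auto simp: nth_append greedy_def less_Suc_eq)

definition pulls :: "nat list \<Rightarrow> (nat \<times> nat \<Rightarrow> real) \<Rightarrow> nat \<Rightarrow> nat \<Rightarrow> nat set" where
  "pulls arms Y i t = {s. s < t \<and> greedy arms Y s = i}"

lemma finite_pulls [simp]: "finite (pulls arms Y i t)"
  by (simp add: pulls_def)

lemma card_pulls_le: "card (pulls arms Y i t) \<le> t"
  using card_mono[of "{..<t}" "pulls arms Y i t"] by (auto simp: pulls_def)

lemma pulls_eq_hist: "pulls arms Y i t = {s. s < t \<and> greedy_hist arms Y t ! s = i}"
  by (auto simp: pulls_def nth_greedy_hist)

lemma emp_mean_hist: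
  "emp_mean Y (greedy_hist arms Y t) i
     = (\<Sum>s\<in>pulls arms Y i t. Y (i, s)) / real (card (pulls arms Y i t))"
  by (simp add: emp_mean_def pulls_eq_hist)

lemma greedy_init: "t < length arms \<Longrightarrow> greedy arms Y t = arms ! t"
  by (simp add: greedy_def greedy_next_def)

text \<open>The maximum over the finite nonempty set of arms is attained, so the filtered list is
  nonempty and its \<open>hd\<close> is a genuine maximiser.\<close>

lemma greedy_exploit:
  assumes "arms \<noteq> []" "length arms \<le> t"
  shows "greedy arms Y t \<in> {i \<in> set arms. \<forall>j\<in>set arms.
           emp_mean Y (greedy_hist arms Y t) j \<le> emp_mean Y (greedy_hist arms Y t) i}"
proof -
  let ?e = "emp_mean Y (greedy_hist arms Y t)"
  let ?l = "filter (\<lambda>i. \<forall>j\<in>set arms. ?e j \<le> ?e i) arms"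
  have "Max (?e ` set arms) \<in> ?e ` set arms"
    using assms by (intro Max_in) auto
  then obtain i where "i \<in> set arms" "?e i = Max (?e ` set arms)" by auto
  then have "i \<in> set ?l" by auto
  then have "?l \<noteq> []" by force
  then have "hd ?l \<in> set ?l" by (rule hd_in_set)
  also have "set ?l = {i \<in> set arms. \<forall>j\<in>set arms. ?e j \<le> ?e i}" by (rule set_filter)
  also have "hd ?l = greedy arms Y t"
    using assms(2) by (simp add: greedy_def greedy_next_def)
  finally show ?thesis .
qed

lemma greedy_in_arms:
  assumes "arms \<noteq> []"
  shows "greedy arms Y t \<in> set arms"
proof (cases "t < length arms")
  case True
  then show ?thesis by (simp add: greedy_init)
next
  case False
  then have "length arms \<le> t" by simp
  from greedy_exploit[OF assms this] show ?thesis by blast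
qed

text \<open>This is predictability: the choice at time \<open>t\<close> is a function of the first
  \<open>t\<close> columns. History, means and choice are proved together because each new history
  is built from the previous choice, and each choice from the current means.\<close>

lemma greedy_hist_cong:
  assumes "\<And>i s. i \<in> set arms \<Longrightarrow> s < t \<Longrightarrow> Y (i, s) = Y' (i, s)"
  shows "greedy_hist arms Y t = greedy_hist arms Y' t
       \<and> (\<forall>i\<in>set arms. \<forall>s\<le>t. emp_mean Y (greedy_hist arms Y s) i = emp_mean Y' (greedy_hist arms Y' s) i)
       \<and> greedy arms Y t = greedy arms Y' t"
  using assms
proof (induction t)
  case 0
  then show ?case
    by (auto simp: greedy_def greedy_next_def emp_mean_def cong: filter_cong)
next
  case (Suc t)
  then have IH: "greedy_hist arms Y t = greedy_hist arms Y' t"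
    "\<forall>i\<in>set arms. \<forall>s\<le>t. emp_mean Y (greedy_hist arms Y s) i = emp_mean Y' (greedy_hist arms Y' s) i"
    "greedy arms Y t = greedy arms Y' t"
    by auto
  then have hist: "greedy_hist arms Y (Suc t) = greedy_hist arms Y' (Suc t)"
    by (simp add: greedy_def)
  have emp: "emp_mean Y (greedy_hist arms Y (Suc t)) i = emp_mean Y' (greedy_hist arms Y' (Suc t)) i"
    if "i \<in> set arms" for i
    unfolding hist emp_mean_def
    by (intro arg_cong2[where f = "(/)"] sum.cong refl Suc.prems that)
      (simp del: greedy_hist.simps)
  have "greedy arms Y (Suc t) = greedy arms Y' (Suc t)"
    using emp hist by (simp add: greedy_def greedy_next_def cong: filter_cong del: greedy_hist.simps)
  with IH hist emp show ?case
    by (auto simp: le_Suc_eq simp del: greedy_hist.simps)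
qed

text \<open>Asking for a nonempty set of pulls excludes the default mean \<open>0 / 0 = 0\<close> of
  an arm not yet pulled. The property persists in \<open>t\<close> and refers only to rewards before
  \<open>t\<close>, so it may steer a predictable coefficient.\<close>

definition crossed :: "nat list \<Rightarrow> real \<Rightarrow> (nat \<times> nat \<Rightarrow> real) \<Rightarrow> nat \<Rightarrow> nat \<Rightarrow> bool" where
  "crossed arms \<theta> Y i t \<longleftrightarrow>
     (\<exists>r\<le>t. pulls arms Y i r \<noteq> {} \<and> emp_mean Y (greedy_hist arms Y r) i \<le> \<theta>)"

section \<open>Measurability of the greedy trajectory\<close>

context subgaussian_table
begin

lemma measurable_emp_mean_fixed [measurable]: "(\<lambda>Y. emp_mean Y h i) \<in> borel_measurable (table k n)"
  unfolding emp_mean_def by measurable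

text \<open>The history is frozen, which leaves finitely many comparisons of measurable means.
  Histories form a countable type, so the random history can be substituted afterwards by
  \<open>measurable_compose_countable\<close>.\<close>

lemma measurable_greedy_next_fixed: "(\<lambda>Y. greedy_next arms Y h) \<in> measurable (table k n) (count_space UNIV)"
proof -
  \<comment> \<open>Only the filtered list is generalised to \<open>l\<close>; the arms compared
    against stay fixed, which lets the induction go through.\<close>
  have "(\<lambda>Y. filter (\<lambda>i. \<forall>j\<in>set arms. emp_mean Y h j \<le> emp_mean Y h i) l)
          \<in> measurable (table k n) (count_space UNIV)" for l
  proof (induction l)
    case (Cons i l)
    have [measurable]: "(\<lambda>Y. i # filter (\<lambda>i. \<forall>j\<in>set arms. emp_mean Y h j \<le> emp_mean Y h i) l)
          \<in> measurable (table k n) (count_space UNIV)"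
      by (rule measurable_compose[OF Cons]) simp
    have "Measurable.pred (table k n) (\<lambda>Y. emp_mean Y h j \<le> emp_mean Y h i)" for j
      unfolding pred_def by (intro borel_measurable_le measurable_emp_mean_fixed)
    then have [measurable]: "Measurable.pred (table k n) (\<lambda>Y. \<forall>j\<in>set arms. emp_mean Y h j \<le> emp_mean Y h i)"
      by (intro pred_intros_finite) auto
    note Cons [measurable]
    show ?case by (simp, measurable)
  qed simp
  from measurable_compose[OF this[of arms], of hd "count_space UNIV"] show ?thesis
    unfolding greedy_next_def by simp
qed

lemma measurable_greedy_hist [measurable]:
  "(\<lambda>Y. greedy_hist arms Y t) \<in> measurable (table k n) (count_space UNIV)"
proof (induction t)
  case (Suc t)
  have "(\<lambda>Y. h @ [greedy_next arms Y h]) \<in> measurable (table k n) (count_space UNIV)" for h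
    by (rule measurable_compose[OF measurable_greedy_next_fixed]) simp
  from measurable_compose_countable[OF this Suc] show ?case by simp
qed simp

lemma measurable_greedy [measurable]:
  "(\<lambda>Y. greedy arms Y t) \<in> measurable (table k n) (count_space UNIV)"
  unfolding greedy_def
  by (rule measurable_compose_countable[OF measurable_greedy_next_fixed measurable_greedy_hist])

lemma measurable_emp_mean [measurable]:
  "(\<lambda>Y. emp_mean Y (greedy_hist arms Y t) i) \<in> borel_measurable (table k n)"
  by (rule measurable_compose_countable[OF measurable_emp_mean_fixed measurable_greedy_hist])

lemma measurable_pulls [measurable]:
  "(\<lambda>Y. card (pulls arms Y i t)) \<in> measurable (table k n) (count_space UNIV)"
  unfolding pulls_eq_hist
  by (rule measurable_compose[OF measurable_greedy_hist]) simp

lemma measurable_crossed: "Measurable.pred (table k n) (\<lambda>Y. crossed arms \<theta> Y i t)"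
proof -
  have "crossed arms \<theta> Y i t \<longleftrightarrow>
     (\<exists>r\<in>{..t}. card (pulls arms Y i r) \<noteq> 0 \<and> emp_mean Y (greedy_hist arms Y r) i \<le> \<theta>)" for Y
    by (auto simp: crossed_def)
  moreover have "Measurable.pred (table k n)
      (\<lambda>Y. \<exists>r\<in>{..t}. card (pulls arms Y i r) \<noteq> 0 \<and> emp_mean Y (greedy_hist arms Y r) i \<le> \<theta>)"
  proof (intro pred_intros_finite pred_intros_logic finite_atMost)
    show "Measurable.pred (table k n) (\<lambda>Y. card (pulls arms Y i r) = 0)" for r
      by measurable
    show "Measurable.pred (table k n) (\<lambda>Y. emp_mean Y (greedy_hist arms Y r) i \<le> \<theta>)" for r
      unfolding pred_def by (intro borel_measurable_le measurable_emp_mean) simp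
  qed
  ultimately show ?thesis by simp
qed

lemma measurable_crossed_greedy [measurable]:
  "Measurable.pred (table k n) (\<lambda>Y. crossed arms \<theta> Y (greedy arms Y t) t)"
  by (rule measurable_compose_countable[OF measurable_crossed measurable_greedy])

end

section \<open>Two coefficient schemes along the greedy trajectory\<close>

locale greedy_run = subgaussian_table +
  fixes arms :: "nat list" and k :: nat
  assumes arms_nonempty: "arms \<noteq> []"
    and distinct_arms: "distinct arms"
    and arms_subset: "set arms \<subseteq> {..<k}"
begin

text \<open>The pull that causes the first crossing still carries \<open>- \<delta>\<close>; the
  coefficient 0 afterwards freezes the contribution of that arm at its crossing time.\<close>

definition cross_coeff :: "nat set \<Rightarrow> real \<Rightarrow> real \<Rightarrow> nat \<Rightarrow> (nat \<times> nat \<Rightarrow> real) \<Rightarrow> real" where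
  "cross_coeff G \<theta> \<delta> t Y =
     (if greedy arms Y t \<in> G \<and> \<not> crossed arms \<theta> Y (greedy arms Y t) t then - \<delta> else 0)"

definition pull_coeff :: "nat \<Rightarrow> nat \<Rightarrow> real \<Rightarrow> nat \<Rightarrow> (nat \<times> nat \<Rightarrow> real) \<Rightarrow> real" where
  "pull_coeff j n d t Y = (if greedy arms Y t = j \<and> card (pulls arms Y j t) < n then d else 0)"

abbreviation "gproc \<equiv> exp_process (\<lambda>t Y. greedy arms Y t)"

lemma pulls_cong:
  assumes "\<And>i s. i < k \<Longrightarrow> s < t \<Longrightarrow> Y (i, s) = Y' (i, s)" "r \<le> t"
  shows "pulls arms Y i r = pulls arms Y' i r"
proof -
  have "greedy_hist arms Y r = greedy_hist arms Y' r"
    using greedy_hist_cong[of arms r Y Y'] assms arms_subset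
    by (meson lessThan_iff order_less_le_trans subsetD)
  then show ?thesis by (simp add: pulls_eq_hist)
qed

lemma cross_process_expectation:
  "integrable (table k T) (gproc (cross_coeff G \<theta> \<delta>) T) \<and> (\<integral>Y. gproc (cross_coeff G \<theta> \<delta>) T Y \<partial>table k T) \<le> 1"
proof (rule exp_process_expectation)
  show "(\<lambda>Y. greedy arms Y t) \<in> measurable (table k n) (count_space UNIV)" for t n by measurable
  show "cross_coeff G \<theta> \<delta> t \<in> borel_measurable (table k n)" for t n
    unfolding cross_coeff_def by measurable
  show "greedy arms Y t < k" for t Y
    using greedy_in_arms[OF arms_nonempty] arms_subset by auto
next
  fix t :: nat and Y Y' :: "nat \<times> nat \<Rightarrow> real"
  assume eq: "\<And>i s. i < k \<Longrightarrow> s < t \<Longrightarrow> Y (i, s) = Y' (i, s)"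
  have g: "greedy arms Y t = greedy arms Y' t"
    and emp: "\<And>i s. i \<in> set arms \<Longrightarrow> s \<le> t
      \<Longrightarrow> emp_mean Y (greedy_hist arms Y s) i = emp_mean Y' (greedy_hist arms Y' s) i"
    using greedy_hist_cong[of arms t Y Y'] eq arms_subset by auto
  have "crossed arms \<theta> Y i t = crossed arms \<theta> Y' i t" if "i \<in> set arms" for i
    using emp that pulls_cong[where t = t and Y = Y and Y' = Y', OF eq] by (auto simp: crossed_def)
  with g greedy_in_arms[OF arms_nonempty]
  show "greedy arms Y t = greedy arms Y' t \<and> cross_coeff G \<theta> \<delta> t Y = cross_coeff G \<theta> \<delta> t Y'"
    by (simp add: cross_coeff_def)
qed

lemma pull_process_expectation:
  "integrable (table k T) (gproc (pull_coeff j n d) T) \<and> (\<integral>Y. gproc (pull_coeff j n d) T Y \<partial>table k T) \<le> 1"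
proof (rule exp_process_expectation)
  show "(\<lambda>Y. greedy arms Y t) \<in> measurable (table k n) (count_space UNIV)" for t n by measurable
  show "pull_coeff j n d t \<in> borel_measurable (table k m)" for t m
    unfolding pull_coeff_def by measurable
  show "greedy arms Y t < k" for t Y
    using greedy_in_arms[OF arms_nonempty] arms_subset by auto
next
  fix t :: nat and Y Y' :: "nat \<times> nat \<Rightarrow> real"
  assume eq: "\<And>i s. i < k \<Longrightarrow> s < t \<Longrightarrow> Y (i, s) = Y' (i, s)"
  have "greedy arms Y t = greedy arms Y' t"
    using greedy_hist_cong[of arms t Y Y'] eq arms_subset by auto
  then show "greedy arms Y t = greedy arms Y' t \<and> pull_coeff j n d t Y = pull_coeff j n d t Y'"
    using pulls_cong[where t = t and r = t and Y = Y and Y' = Y', OF eq order.refl] by (simp add: pull_coeff_def)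
qed

text \<open>If an arm of \<open>G\<close> first crosses after \<open>n\<close> pulls, its reward sum
  is at most \<open>n * (\<mu> i - \<delta>)\<close>, so it adds at least
  \<open>n * \<delta>\<^sup>2 - n * \<delta>\<^sup>2 / 2\<close> to the exponent. As
  \<open>n \<ge> 1\<close>, this is at least \<open>\<delta>\<^sup>2 / 2\<close>, and the
  contributions of different arms add up however their pulls interleave.\<close>

lemma cross_process_ge:
  assumes "0 < \<delta>" "finite G" "\<And>i. i \<in> G \<Longrightarrow> \<theta> \<le> \<mu> i - \<delta>"
    and all: "\<And>i. i \<in> G \<Longrightarrow> \<exists>t<T. crossed arms \<theta> Y i t"
  shows "exp (real (card G) * \<delta>\<^sup>2 / 2) \<le> gproc (cross_coeff G \<theta> \<delta>) T Y"
proof -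
  define c where "c = (\<lambda>t. cross_coeff G \<theta> \<delta> t Y)"
  define f where "f t = c t * (Y (greedy arms Y t, t) - \<mu> (greedy arms Y t)) - (c t)\<^sup>2 / 2" for t
  have arm: "\<delta>\<^sup>2 / 2 \<le> (\<Sum>t\<in>pulls arms Y i T. f t)" if i: "i \<in> G" for i
  proof -
    define Q where "Q r \<longleftrightarrow> pulls arms Y i r \<noteq> {} \<and> emp_mean Y (greedy_hist arms Y r) i \<le> \<theta>" for r
    define \<sigma> where "\<sigma> = (LEAST r. Q r)"
    obtain t r where tr: "t < T" "r \<le> t" "Q r"
      using all[OF i] by (auto simp: crossed_def Q_def)
    have Q: "Q \<sigma>" unfolding \<sigma>_def by (rule LeastI[where P = Q, OF tr(3)])
    have le: "\<sigma> \<le> s" if "Q s" for s unfolding \<sigma>_def by (rule Least_le[where P = Q, OF that])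
    have crossed: "crossed arms \<theta> Y i s \<longleftrightarrow> \<sigma> \<le> s" for s
      using Q le unfolding crossed_def Q_def[symmetric] by (meson order.trans)
    have "\<sigma> \<le> T" using le[OF tr(3)] tr by simp
    define n where "n = card (pulls arms Y i \<sigma>)"
    define S where "S = (\<Sum>s\<in>pulls arms Y i \<sigma>. Y (i, s))"
    have n: "n \<ge> 1" using Q by (simp add: n_def Q_def Suc_le_eq card_gt_0_iff)
    have "S / n \<le> \<theta>" using Q by (simp add: Q_def emp_mean_hist n_def S_def)
    then have "S \<le> n * \<theta>" using n by (simp add: field_simps)
    also have "\<dots> \<le> n * (\<mu> i - \<delta>)" using assms(3)[OF i] n by (intro mult_left_mono) auto
    finally have S: "S \<le> n * (\<mu> i - \<delta>)" .
    have fi: "f s = (if \<sigma> \<le> s then 0 else - \<delta> * (Y (i, s) - \<mu> i) - \<delta>\<^sup>2 / 2)"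
      if "greedy arms Y s = i" for s
      using i by (simp add: f_def c_def cross_coeff_def that crossed)
    have "(\<Sum>t\<in>pulls arms Y i T. f t) = (\<Sum>t\<in>pulls arms Y i \<sigma>. f t)"
      using \<open>\<sigma> \<le> T\<close> fi by (intro sum.mono_neutral_right) (auto simp: pulls_def)
    also have "\<dots> = (\<Sum>t\<in>pulls arms Y i \<sigma>. - \<delta> * (Y (i, t) - \<mu> i) - \<delta>\<^sup>2 / 2)"
      using fi by (intro sum.cong) (auto simp: pulls_def)
    also have "\<dots> = - \<delta> * (S - n * \<mu> i) - n * (\<delta>\<^sup>2 / 2)"
      by (simp add: sum_subtractf S_def n_def sum_distrib_left sum_negf sum.distrib algebra_simps)
    also have "\<dots> \<ge> \<delta> * (n * \<delta>) - n * (\<delta>\<^sup>2 / 2)"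
      using mult_left_mono[OF S, of \<delta>] \<open>0 < \<delta>\<close> by (simp add: algebra_simps)
    also have "\<delta> * (n * \<delta>) - n * (\<delta>\<^sup>2 / 2) = n * (\<delta>\<^sup>2 / 2)"
      by (simp add: power2_eq_square)
    also have "1 * (\<delta>\<^sup>2 / 2) \<le> n * (\<delta>\<^sup>2 / 2)" using n by (intro mult_right_mono) auto
    finally show ?thesis by simp
  qed
  have "real (card G) * \<delta>\<^sup>2 / 2 = (\<Sum>i\<in>G. \<delta>\<^sup>2 / 2)" by simp
  also have "\<dots> \<le> (\<Sum>i\<in>G. \<Sum>t\<in>pulls arms Y i T. f t)" by (intro sum_mono arm)
  \<comment> \<open>The sums over arms are regrouped into one sum over time; a step that pulls an
    arm outside \<open>G\<close> contributes 0.\<close>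
  also have "\<dots> = (\<Sum>i\<in>G. sum f {t \<in> {t. t < T \<and> greedy arms Y t \<in> G}. greedy arms Y t = i})"
    by (intro sum.cong refl) (auto simp: pulls_def)
  also have "\<dots> = sum f {t. t < T \<and> greedy arms Y t \<in> G}"
    using assms(2) by (intro sum.group) auto
  also have "\<dots> = sum f {..<T}"
    by (intro sum.mono_neutral_left) (auto simp: f_def c_def cross_coeff_def)
  finally show ?thesis by (simp add: exp_process_def f_def c_def)
qed

text \<open>A lucky time is labelled by the number \<open>n\<close> of earlier pulls of
  \<open>j\<close>. If the mean of these \<open>n\<close> rewards exceeds \<open>\<theta>\<close>,
  the process that stops after \<open>n\<close> pulls is at least
  \<open>exp (n * d\<^sup>2 / 2)\<close>, so the matching summand is at least 1. This is Markov's
  inequality kept pathwise, ready for linearity of expectation.\<close>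

lemma card_lucky_pulls_le:
  fixes T j :: nat and Y :: "nat \<times> nat \<Rightarrow> real" and \<theta> :: real
  defines "A \<equiv> {t. t < T \<and> greedy arms Y t = j \<and> pulls arms Y j t \<noteq> {}
                  \<and> \<theta> < emp_mean Y (greedy_hist arms Y t) j}"
    and "d \<equiv> \<theta> - \<mu> j"
  assumes "0 < d"
  shows "real (card A) \<le> (\<Sum>n=1..T. exp (- real n * d\<^sup>2 / 2) * gproc (pull_coeff j n d) T Y)"
proof -
  define N where "N t = card (pulls arms Y j t)" for t
  have less: "N s < N t" if "s < t" "greedy arms Y s = j" for s t
    unfolding N_def by (rule psubset_card_mono) (use that in \<open>auto simp: pulls_def\<close>)
  have mono: "N s \<le> N t" if "s \<le> t" for s t
    unfolding N_def by (rule card_mono) (use that in \<open>auto simp: pulls_def\<close>)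
  \<comment> \<open>Arm \<open>j\<close> is pulled at each time in \<open>A\<close>, so the count
    has strictly grown by the next such time.\<close>
  have inj: "inj_on N A"
    by (rule inj_onI) (metis (mono_tags, lifting) A_def less mem_Collect_eq nat_neq_iff)
  have "N ` A \<subseteq> {1..T}"
  proof
    fix n assume "n \<in> N ` A"
    then obtain t where "t \<in> A" "n = N t" by auto
    then show "n \<in> {1..T}"
      using card_pulls_le[of arms Y j t] by (auto simp: N_def A_def Suc_le_eq card_gt_0_iff)
  qed
  have V: "1 \<le> exp (- real (N t) * d\<^sup>2 / 2) * gproc (pull_coeff j (N t) d) T Y" if "t \<in> A" for t
  proof -
    define c where "c = (\<lambda>s. pull_coeff j (N t) d s Y)"
    define f where "f s = c s * (Y (greedy arms Y s, s) - \<mu> (greedy arms Y s)) - (c s)\<^sup>2 / 2" for s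
    define S where "S = (\<Sum>s\<in>pulls arms Y j t. Y (j, s))"
    have t: "t < T" "greedy arms Y t = j" "N t \<ge> 1" "\<theta> < S / N t"
      using that by (auto simp: A_def emp_mean_hist N_def S_def Suc_le_eq card_gt_0_iff)
    then have S: "N t * \<theta> \<le> S" by (simp add: field_simps)
    \<comment> \<open>From time \<open>t\<close> on the arm already has its \<open>N t\<close>
      pulls, so the coefficient is 0 and the process at \<open>T\<close> keeps its value from time
      \<open>t\<close>.\<close>
    have f0: "f s = 0" if "s \<notin> pulls arms Y j t" for s
    proof (cases "greedy arms Y s = j")
      case True
      then have "N t \<le> N s" using that by (intro mono) (simp add: pulls_def)
      then show ?thesis by (simp add: f_def c_def pull_coeff_def N_def)
    qed (simp add: f_def c_def pull_coeff_def)
    have f1: "f s = d * (Y (j, s) - \<mu> j) - d\<^sup>2 / 2" if "s \<in> pulls arms Y j t" for s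
    proof -
      have s: "s < t" "greedy arms Y s = j" using that by (simp_all add: pulls_def)
      with less[OF s] show ?thesis by (simp add: f_def c_def pull_coeff_def N_def)
    qed
    have "pulls arms Y j t \<subseteq> {..<T}" using t(1) by (auto simp: pulls_def)
    then have "sum f {..<T} = sum f (pulls arms Y j t)"
      using f0 by (intro sum.mono_neutral_right) auto
    also have "\<dots> = (\<Sum>s\<in>pulls arms Y j t. d * (Y (j, s) - \<mu> j) - d\<^sup>2 / 2)"
      by (intro sum.cong refl f1)
    also have "\<dots> = d * (S - N t * \<mu> j) - N t * (d\<^sup>2 / 2)"
      by (simp add: sum_subtractf S_def N_def sum_distrib_left algebra_simps)
    also have "\<dots> \<ge> d * (N t * \<theta> - N t * \<mu> j) - N t * (d\<^sup>2 / 2)"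
      using S \<open>0 < d\<close> by (intro diff_mono mult_left_mono) auto
    also have "d * (N t * \<theta> - N t * \<mu> j) - N t * (d\<^sup>2 / 2) = N t * (d\<^sup>2 / 2)"
      by (simp add: d_def power2_eq_square field_simps)
    finally have "0 \<le> - real (N t) * d\<^sup>2 / 2 + sum f {..<T}" by simp
    then have "1 \<le> exp (- real (N t) * d\<^sup>2 / 2 + sum f {..<T})" by simp
    moreover have "gproc (pull_coeff j (N t) d) T Y = exp (sum f {..<T})"
      by (simp add: exp_process_def f_def c_def)
    ultimately show ?thesis by (simp only: exp_add)
  qed
  have "real (card A) = (\<Sum>t\<in>A. 1)" by simp
  also have "\<dots> \<le> (\<Sum>t\<in>A. exp (- real (N t) * d\<^sup>2 / 2) * gproc (pull_coeff j (N t) d) T Y)"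
    by (intro sum_mono V)
  also have "\<dots> = (\<Sum>n\<in>N ` A. exp (- real n * d\<^sup>2 / 2) * gproc (pull_coeff j n d) T Y)"
    by (simp add: sum.reindex[OF inj])
  also have "\<dots> \<le> (\<Sum>n=1..T. exp (- real n * d\<^sup>2 / 2) * gproc (pull_coeff j n d) T Y)"
    using \<open>N ` A \<subseteq> {1..T}\<close> by (intro sum_mono2) (auto simp: exp_process_def)
  finally show ?thesis .
qed

end


subsection \<open>Expected regret for fixed means\<close>

text \<open>By convexity \<open>exp\<close> lies below its chord over \<open>[-1, 0]\<close>; the
  slope of that chord is the source of the constant \<open>1 - exp (-1)\<close>.\<close>

lemma one_minus_exp_ge:
  fixes y :: real
  assumes "0 \<le> y" "y \<le> 1"
  shows "(1 - exp (-1)) * y \<le> 1 - exp (- y)"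
proof -
  have "exp ((1 - y) *\<^sub>R 0 + y *\<^sub>R (-1 :: real)) \<le> (1 - y) * exp 0 + y * exp (-1)"
    using assms by (intro convex_onD[OF exp_convex]) auto
  then show ?thesis by (simp add: algebra_simps)
qed

text \<open>The leading 1 is the term \<open>n = 0\<close> of a geometric series with ratio
  \<open>exp (- d\<^sup>2 / 2)\<close>, and the chord bound at \<open>d\<^sup>2 / 2\<close> controls
  one minus the ratio.\<close>

lemma geometric_exp_sum_le:
  fixes d :: real
  assumes "0 < d" "d \<le> 1"
  shows "1 + (\<Sum>n=1..T. exp (- real n * d\<^sup>2 / 2)) \<le> 1 / ((1 - exp (-1)) / 2 * d\<^sup>2)"
proof -
  define x where "x = exp (- d\<^sup>2 / 2)"
  have d2: "0 < d\<^sup>2" "d\<^sup>2 \<le> 1" using assms by (auto simp: power_le_one)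
  have x: "0 < x" "x < 1" using d2 by (auto simp: x_def)
  have pow: "exp (- real n * d\<^sup>2 / 2) = x ^ n" for n
    by (simp add: x_def flip: exp_of_nat_mult)
  have "{..T} = insert 0 {1..T}" by auto
  then have "1 + (\<Sum>n=1..T. exp (- real n * d\<^sup>2 / 2)) = (\<Sum>n\<le>T. x ^ n)"
    unfolding pow by simp
  also have "\<dots> = (1 - x ^ Suc T) / (1 - x)"
    using x by (simp add: sum_gp0)
  also have "\<dots> \<le> 1 / (1 - x)"
    using x by (intro divide_right_mono) auto
  also have "\<dots> \<le> 1 / ((1 - exp (-1)) / 2 * d\<^sup>2)"
    using one_minus_exp_ge[of "d\<^sup>2 / 2"] d2 x by (intro divide_left_mono) (auto simp: x_def)
  finally show ?thesis .
qed

text \<open>With \<open>d = 1 - 2 * \<delta> - x\<close>, this is the loss per pull, at most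
  \<open>3 * d\<close>, times the bound \<open>1 / (C1 * d\<^sup>2)\<close> on the expected number
  of pulls, where \<open>C1 = (1 - exp (-1)) / 2\<close>. Arms within \<open>3 * \<delta>\<close> of
  1 cost nothing here; their loss is charged to \<open>3 * \<delta> * T\<close>.\<close>

definition gap_cost :: "real \<Rightarrow> real \<Rightarrow> real" where
  "gap_cost \<delta> x = (if x < 1 - 3 * \<delta> then 3 / ((1 - exp (-1)) / 2 * (1 - 2 * \<delta> - x)) else 0)"

context greedy_run
begin

text \<open>If all good arms cross, the first term alone is at least \<open>T\<close>. Otherwise
  some good arm keeps its empirical mean above \<open>\<theta>\<close>, so greedy pulls a bad arm
  only once at initialisation and then only at lucky times. The inequality holds for every table, so
  its expectation follows by linearity.\<close>

lemma pathwise_regret_le: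
  fixes T :: nat and Y :: "nat \<times> nat \<Rightarrow> real" and \<delta> :: real
  defines "\<theta> \<equiv> 1 - 2 * \<delta>"
    and "G \<equiv> {i \<in> set arms. \<mu> i > 1 - \<delta>}"
    and "B \<equiv> {j \<in> set arms. \<mu> j < 1 - 3 * \<delta>}"
  assumes "0 < \<delta>" and \<mu>: "\<And>i. i \<in> set arms \<Longrightarrow> 0 \<le> \<mu> i \<and> \<mu> i \<le> 1"
  shows "(\<Sum>t<T. 1 - \<mu> (greedy arms Y t))
    \<le> real T * exp (- real (card G) * \<delta>\<^sup>2 / 2) * gproc (cross_coeff G \<theta> \<delta>) T Y + 3 * \<delta> * real T
      + (\<Sum>j\<in>B. (1 - \<mu> j) * (1 + (\<Sum>n=1..T. exp (- real n * (\<theta> - \<mu> j)\<^sup>2 / 2)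
                                    * gproc (pull_coeff j n (\<theta> - \<mu> j)) T Y)))"
    (is "?L \<le> ?bad + _ + (\<Sum>j\<in>B. ?N j)")
proof -
  have a: "greedy arms Y t \<in> set arms" for t by (rule greedy_in_arms[OF arms_nonempty])
  have bad0: "0 \<le> ?bad" by (simp add: exp_process_def)
  have N0: "0 \<le> ?N j" if "j \<in> B" for j
    using \<mu>[of j] that by (auto simp: B_def exp_process_def intro!: mult_nonneg_nonneg add_nonneg_nonneg sum_nonneg)
  have "finite G" "finite B" by (auto simp: G_def B_def)
  show ?thesis
  proof (cases "\<forall>i\<in>G. \<exists>t<T. crossed arms \<theta> Y i t")
    \<comment> \<open>This case includes empty \<open>G\<close>, for which the exponential and the
      process are both 1.\<close>
    case True
    have "exp (real (card G) * \<delta>\<^sup>2 / 2) \<le> gproc (cross_coeff G \<theta> \<delta>) T Y"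
      using True by (intro cross_process_ge) (auto simp: \<open>0 < \<delta>\<close> G_def \<theta>_def)
    then have "real T * exp (- real (card G) * \<delta>\<^sup>2 / 2) * exp (real (card G) * \<delta>\<^sup>2 / 2) \<le> ?bad"
      by (intro mult_left_mono) auto
    then have "real T \<le> ?bad" by (simp add: mult.assoc flip: exp_add)
    moreover have "?L \<le> real T" using sum_mono[of "{..<T}" "\<lambda>t. 1 - \<mu> (greedy arms Y t)" "\<lambda>_. 1"] \<mu>[OF a] by simp
    moreover have "0 \<le> (\<Sum>j\<in>B. ?N j)" by (intro sum_nonneg N0)
    moreover have "0 \<le> 3 * \<delta> * real T" using \<open>0 < \<delta>\<close> by simp
    ultimately show ?thesis by linarith
  next
    case False
    then obtain i where i: "i \<in> G" "\<And>t. t < T \<Longrightarrow> \<not> crossed arms \<theta> Y i t" by auto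
    have N: "real (card {t \<in> {..<T}. greedy arms Y t = j}) * (1 - \<mu> j) \<le> ?N j" if j: "j \<in> B" for j
    proof -
      define A where "A = {t. t < T \<and> greedy arms Y t = j \<and> pulls arms Y j t \<noteq> {}
                  \<and> \<theta> < emp_mean Y (greedy_hist arms Y t) j}"
      have "j \<in> set arms" using j by (auto simp: B_def)
      then obtain s where s: "s < length arms" "arms ! s = j" by (auto simp: in_set_conv_nth)
      \<comment> \<open>\<open>s\<close> is the initialisation slot of \<open>j\<close>, the only
        one since the arms are distinct. At any later pull of \<open>j\<close> its empirical mean is
        at least that of the uncrossed arm \<open>i\<close>, hence above
        \<open>\<theta>\<close>.\<close>
      have "{t \<in> {..<T}. greedy arms Y t = j} \<subseteq> insert s A"
      proof safe
        fix t assume t: "t < T" "j = greedy arms Y t" "t \<notin> A"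
        show "t = s"
        proof (cases "t < length arms")
          case True
          then show ?thesis using t s distinct_arms by (simp add: greedy_init nth_eq_iff_index_eq)
        next
          case False
          then have le: "length arms \<le> t" by simp
          have pulled: "pulls arms Y l t \<noteq> {}" if l: "l \<in> set arms" for l
          proof -
            obtain r where "r < length arms" "arms ! r = l" using l by (auto simp: in_set_conv_nth)
            then have "r \<in> pulls arms Y l t" using le by (simp add: pulls_def greedy_init)
            then show ?thesis by auto
          qed
          have "i \<in> set arms" using i(1) by (simp add: G_def)
          then have "\<theta> < emp_mean Y (greedy_hist arms Y t) i"
            using i(2)[OF t(1)] pulled[of i] by (auto simp: crossed_def not_le)
          also have "\<dots> \<le> emp_mean Y (greedy_hist arms Y t) j"
            using greedy_exploit[OF arms_nonempty le, of Y] t(2) \<open>i \<in> set arms\<close> by blast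
          finally have "t \<in> A"
            using t pulled[OF \<open>j \<in> set arms\<close>] by (simp add: A_def)
          then show ?thesis using t(3) by simp
        qed
      qed
      then have "card {t \<in> {..<T}. greedy arms Y t = j} \<le> card (insert s A)"
        by (intro card_mono) (auto simp: A_def)
      also have "\<dots> \<le> 1 + card A" by (simp add: card_insert_le_m1 card_insert_if A_def)
      finally have "real (card {t \<in> {..<T}. greedy arms Y t = j}) \<le> 1 + real (card A)" by simp
      also have "real (card A) \<le> (\<Sum>n=1..T. exp (- real n * (\<theta> - \<mu> j)\<^sup>2 / 2)
                                    * gproc (pull_coeff j n (\<theta> - \<mu> j)) T Y)"
        unfolding A_def by (rule card_lucky_pulls_le) (use j \<open>0 < \<delta>\<close> in \<open>auto simp: B_def \<theta>_def\<close>)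
      finally have "real (card {t \<in> {..<T}. greedy arms Y t = j})
          \<le> 1 + (\<Sum>n=1..T. exp (- real n * (\<theta> - \<mu> j)\<^sup>2 / 2) * gproc (pull_coeff j n (\<theta> - \<mu> j)) T Y)"
        by simp
      then show ?thesis
        using \<mu>[OF \<open>j \<in> set arms\<close>] by (subst mult.commute) (intro mult_left_mono, auto)
    qed
    \<comment> \<open>Each step is charged \<open>3 * \<delta>\<close>, which already pays for arms
      outside \<open>B\<close>; arms in \<open>B\<close> are charged their full loss as well and
      then counted per arm.\<close>
    have "?L \<le> (\<Sum>t<T. 3 * \<delta> + (if greedy arms Y t \<in> B then 1 - \<mu> (greedy arms Y t) else 0))"
      using a \<open>0 < \<delta>\<close> by (intro sum_mono) (auto simp: B_def)
    also have "\<dots> = 3 * \<delta> * real T + (\<Sum>t\<in>{t \<in> {..<T}. greedy arms Y t \<in> B}. 1 - \<mu> (greedy arms Y t))"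
      by (subst sum.inter_filter) (simp_all add: sum.distrib)
    also have "(\<Sum>t\<in>{t \<in> {..<T}. greedy arms Y t \<in> B}. 1 - \<mu> (greedy arms Y t))
        = (\<Sum>j\<in>B. \<Sum>t\<in>{t \<in> {t \<in> {..<T}. greedy arms Y t \<in> B}. greedy arms Y t = j}. 1 - \<mu> (greedy arms Y t))"
      using \<open>finite B\<close> by (intro sum.group[symmetric]) auto
    also have "\<dots> = (\<Sum>j\<in>B. \<Sum>t\<in>{t \<in> {..<T}. greedy arms Y t = j}. 1 - \<mu> j)"
      by (intro sum.cong) auto
    also have "\<dots> \<le> (\<Sum>j\<in>B. ?N j)"
      using N by (intro sum_mono) simp
    finally show ?thesis using bad0 by simp
  qed
qed

text \<open>All the processes have expectation at most 1 and drop out of the pathwise bound. The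
  factor depending on the number of good arms is rewritten as a product over arms, so that it
  factorises under independent means.\<close>

lemma expected_regret_le:
  assumes "0 < \<delta>" and \<mu>: "\<And>i. i \<in> set arms \<Longrightarrow> 0 \<le> \<mu> i \<and> \<mu> i \<le> 1"
  shows "real T - (\<Sum>t<T. \<integral>Y. \<mu> (greedy arms Y t) \<partial>table k T)
    \<le> real T * (\<Prod>i\<in>set arms. if \<mu> i > 1 - \<delta> then exp (- \<delta>\<^sup>2 / 2) else 1) + 3 * \<delta> * real T
      + (\<Sum>j\<in>set arms. gap_cost \<delta> (\<mu> j))"
proof -
  define \<theta> where "\<theta> = 1 - 2 * \<delta>"
  define G where "G = {i \<in> set arms. \<mu> i > 1 - \<delta>}"
  define B where "B = {j \<in> set arms. \<mu> j < 1 - 3 * \<delta>}"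
  define V where "V = gproc (cross_coeff G \<theta> \<delta>) T"
  define W where "W j n = gproc (pull_coeff j n (\<theta> - \<mu> j)) T" for j n
  define e where "e j n = exp (- real n * (\<theta> - \<mu> j)\<^sup>2 / 2)" for j and n :: nat
  interpret tab: prob_space "table k T" by (rule prob_space_table)
  have V: "integrable (table k T) V" "(\<integral>Y. V Y \<partial>table k T) \<le> 1"
    unfolding V_def using cross_process_expectation by auto
  have W: "integrable (table k T) (W j n)" "(\<integral>Y. W j n Y \<partial>table k T) \<le> 1" for j n
    unfolding W_def using pull_process_expectation by auto
  have int: "integrable (table k T) (\<lambda>Y. \<mu> (greedy arms Y t))" for t
  proof (rule tab.integrable_const_bound[where B = 1])
    show "AE Y in table k T. norm (\<mu> (greedy arms Y t)) \<le> 1"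
      using \<mu>[OF greedy_in_arms[OF arms_nonempty]] by simp
    show "(\<lambda>Y. \<mu> (greedy arms Y t)) \<in> borel_measurable (table k T)"
      by (rule measurable_compose[OF measurable_greedy]) simp
  qed
  have "real T - (\<Sum>t<T. \<integral>Y. \<mu> (greedy arms Y t) \<partial>table k T)
      = (\<integral>Y. (\<Sum>t<T. 1 - \<mu> (greedy arms Y t)) \<partial>table k T)"
    using int by (simp add: sum_subtractf tab.prob_space)
  also have "\<dots> \<le> (\<integral>Y. real T * exp (- real (card G) * \<delta>\<^sup>2 / 2) * V Y + 3 * \<delta> * real T
      + (\<Sum>j\<in>B. (1 - \<mu> j) * (1 + (\<Sum>n=1..T. e j n * W j n Y))) \<partial>table k T)"
    using pathwise_regret_le[where T = T, OF assms] int V W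
    by (intro integral_mono) (auto simp: V_def W_def e_def \<theta>_def G_def B_def)
  also have "\<dots> = real T * exp (- real (card G) * \<delta>\<^sup>2 / 2) * (\<integral>Y. V Y \<partial>table k T) + 3 * \<delta> * real T
      + (\<Sum>j\<in>B. (1 - \<mu> j) * (1 + (\<Sum>n=1..T. e j n * (\<integral>Y. W j n Y \<partial>table k T))))"
    using V W by (simp add: tab.prob_space)
  also have "\<dots> \<le> real T * exp (- real (card G) * \<delta>\<^sup>2 / 2) * 1 + 3 * \<delta> * real T
      + (\<Sum>j\<in>B. (1 - \<mu> j) * (1 + (\<Sum>n=1..T. e j n * 1)))"
    using V W \<mu> \<open>0 < \<delta>\<close> by (intro add_mono mult_left_mono sum_mono) (auto simp: B_def e_def)
  also have "(\<Sum>j\<in>B. (1 - \<mu> j) * (1 + (\<Sum>n=1..T. e j n * 1))) \<le> (\<Sum>j\<in>B. gap_cost \<delta> (\<mu> j))"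
  proof (rule sum_mono)
    fix j assume "j \<in> B"
    then have j: "0 \<le> \<mu> j" "\<mu> j < 1 - 3 * \<delta>" "\<mu> j \<le> 1" using \<mu> by (auto simp: B_def)
    define d where "d = \<theta> - \<mu> j"
    define C where "C = (1 - exp (-1 :: real)) / 2"
    have "0 < C" by (simp add: C_def)
    have d: "\<delta> < d" "0 < d" "d \<le> 1" using j \<open>0 < \<delta>\<close> by (auto simp: d_def \<theta>_def)
    \<comment> \<open>Since \<open>d > \<delta>\<close>, the loss
      \<open>1 - \<mu> j = d + 2 * \<delta>\<close> is below \<open>3 * d\<close>.\<close>
    have "(1 - \<mu> j) * (1 + (\<Sum>n=1..T. e j n * 1)) \<le> (3 * d) * (1 / (C * d\<^sup>2))"
      using geometric_exp_sum_le[OF d(2,3), of T] j d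
      by (intro mult_mono) (auto simp: e_def d_def C_def \<theta>_def intro!: add_nonneg_nonneg sum_nonneg)
    also have "\<dots> = 3 / (C * d)"
      using d by (simp add: power2_eq_square)
    also have "\<dots> = gap_cost \<delta> (\<mu> j)"
      using j by (simp add: gap_cost_def C_def d_def \<theta>_def)
    finally show "(1 - \<mu> j) * (1 + (\<Sum>n=1..T. e j n * 1)) \<le> gap_cost \<delta> (\<mu> j)" .
  qed
  also have "(\<Sum>j\<in>B. gap_cost \<delta> (\<mu> j)) = (\<Sum>j\<in>set arms. gap_cost \<delta> (\<mu> j))"
    by (intro sum.mono_neutral_left) (auto simp: B_def gap_cost_def)
  also have "exp (- real (card G) * \<delta>\<^sup>2 / 2) = (\<Prod>i\<in>G. exp (- \<delta>\<^sup>2 / 2))"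
    by (simp add: flip: exp_of_nat_mult)
  also have "\<dots> = (\<Prod>i\<in>set arms. if \<mu> i > 1 - \<delta> then exp (- \<delta>\<^sup>2 / 2) else 1)"
    unfolding G_def by (rule prod.inter_filter) simp
  finally show ?thesis by simp
qed

end


subsection \<open>Averaging over the prior\<close>

locale bayesian_bandit =
  fixes \<Gamma> :: "real measure" and P :: "real \<Rightarrow> real measure" and c0 C0 :: real
  assumes prob_prior: "prob_space \<Gamma>" and sets_prior: "sets \<Gamma> = sets borel"
    and support_prior: "measure \<Gamma> {0..1} = 1"
    and c0_pos: "0 < c0"
    and regular: "one_regular \<Gamma> c0 C0"
    and fam: "\<And>\<mu>. \<mu> \<in> {0..1} \<Longrightarrow> prob_space (P \<mu>) \<and> sets (P \<mu>) = sets borel"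
    and subg: "\<And>\<mu>. \<mu> \<in> {0..1} \<Longrightarrow> one_subgaussian (P \<mu>) \<mu>"
begin

sublocale prior: prob_space \<Gamma> by (rule prob_prior)

lemma measurable_prior: "measurable \<Gamma> N = measurable borel N"
  by (intro measurable_cong_sets sets_prior refl)

lemma space_prior [simp]: "space \<Gamma> = UNIV"
  using sets_eq_imp_space_eq[OF sets_prior] by simp

lemma tail_ge: "0 < \<epsilon> \<Longrightarrow> \<epsilon> \<le> 1 \<Longrightarrow> c0 * \<epsilon> \<le> measure \<Gamma> {x. x > 1 - \<epsilon>}"
  using regular by (simp add: one_regular_def)

lemma tail_le: "0 < \<epsilon> \<Longrightarrow> \<epsilon> \<le> 1 \<Longrightarrow> measure \<Gamma> {x. x \<ge> 1 - \<epsilon>} \<le> C0 * \<epsilon>"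
  using regular by (simp add: one_regular_def)

lemma AE_prior: "AE x in \<Gamma>. x \<in> {0..1}"
  using support_prior by (subst prior.AE_in_set_eq_1) (auto simp: sets_prior)

text \<open>At \<open>\<epsilon> = 1\<close> the tail contains the whole support. The bound later
  lets terms without the factor \<open>C0\<close> be absorbed.\<close>

lemma C0_ge_1: "1 \<le> C0"
proof -
  have "measure \<Gamma> {0..1} \<le> measure \<Gamma> {x. x \<ge> 1 - 1}"
    by (intro prior.finite_measure_mono) (auto simp: sets_prior)
  then have "1 \<le> measure \<Gamma> {x. x \<ge> 1 - 1}" by (simp only: support_prior)
  also have "\<dots> \<le> C0" using tail_le[of 1] by simp
  finally show ?thesis .
qed

lemma gap_cost_bounds:
  assumes "0 < \<delta>"
  shows "0 \<le> gap_cost \<delta> x" "gap_cost \<delta> x \<le> 3 / ((1 - exp (-1)) / 2 * \<delta>)"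
proof -
  have C: "0 < (1 - exp (-1 :: real)) / 2" by simp
  show "0 \<le> gap_cost \<delta> x" using assms C by (auto simp: gap_cost_def)
  show "gap_cost \<delta> x \<le> 3 / ((1 - exp (-1)) / 2 * \<delta>)"
    unfolding gap_cost_def using assms C
    by (auto intro!: divide_left_mono mult_left_mono mult_pos_pos simp del: divide_const_simps)
qed

lemma measurable_gap_cost [measurable]: "gap_cost \<delta> \<in> borel_measurable borel"
  unfolding gap_cost_def by measurable

lemma integrable_gap_cost:
  assumes "0 < \<delta>"
  shows "integrable \<Gamma> (gap_cost \<delta>)"
proof (rule prior.integrable_const_bound)
  show "AE x in \<Gamma>. norm (gap_cost \<delta> x) \<le> 3 / ((1 - exp (-1)) / 2 * \<delta>)"
    using gap_cost_bounds[OF assms] by (intro AE_I2) (simp only: real_norm_def abs_of_nonneg)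
qed (simp add: measurable_prior)

text \<open>Layer-cake: the cost of a gap \<open>1 - x\<close> is the integral of its derivative over all
  gaps between \<open>1 - x\<close> and \<open>1\<close>, and exchanging the integrals leaves only tail probabilities.\<close>

lemma integral_gap_cost_le:
  assumes \<delta>: "0 < \<delta>" "\<delta> \<le> 1 / 3"
  shows "(\<integral>x. gap_cost \<delta> x \<partial>\<Gamma>) \<le> C0 / ((1 - exp (-1)) / 2) * (9 + 3 * ln (1 / \<delta>))"
proof -
  define C1 where "C1 = (1 - exp (-1 :: real)) / 2"
  have "0 < C1" by (simp add: C1_def)
  \<comment> \<open>\<open>h\<close> is minus the derivative of
    \<open>3 / (y - 2 * \<delta>)\<close>, the cost times \<open>C1\<close> at gap \<open>y\<close>.
    Integrating it from \<open>1 - x\<close> to 1 leaves the boundary value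
    \<open>3 / (1 - 2 * \<delta>)\<close> at gap 1.\<close>
  define h where "h y = 3 / (y - 2 * \<delta>)\<^sup>2" for y :: real
  define f where "f x y = (if x < 1 - 3 * \<delta> \<and> 1 - x \<le> y \<and> y \<le> 1 then ennreal (h y) else 0)" for x y :: real
  have h0: "0 \<le> h y" for y by (simp add: h_def)
  have [measurable]: "h \<in> borel_measurable borel" unfolding h_def by measurable
  interpret pair_sigma_finite \<Gamma> lborel
    by (intro pair_sigma_finite.intro prior.sigma_finite_measure sigma_finite_lborel)
  have layer: "ennreal (C1 * gap_cost \<delta> x) \<le> ennreal (3 / (1 - 2 * \<delta>)) + (\<integral>\<^sup>+y. f x y \<partial>lborel)"
    if "0 \<le> x" for x
  proof (cases "x < 1 - 3 * \<delta>")
    case True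
    have "(\<integral>\<^sup>+y. f x y \<partial>lborel) = (\<integral>\<^sup>+y. ennreal (h y) * indicator {1 - x..1} y \<partial>lborel)"
      using True by (intro nn_integral_cong) (auto simp: f_def indicator_def)
    also have "\<dots> = ennreal ((- 3 / (1 - 2 * \<delta>)) - (- 3 / (1 - x - 2 * \<delta>)))"
    proof (rule nn_integral_FTC_Icc[where F = "\<lambda>y. - 3 / (y - 2 * \<delta>)"])
      fix y assume "y \<in> {1 - x..1}"
      then have "y - 2 * \<delta> > 0" using True \<delta> by auto
      then show "((\<lambda>y. - 3 / (y - 2 * \<delta>)) has_real_derivative h y) (at y)"
        by (auto intro!: derivative_eq_intros simp: h_def power2_eq_square)
    qed (use that h0 in auto)
    finally have eq: "(\<integral>\<^sup>+y. f x y \<partial>lborel) = ennreal ((- 3 / (1 - 2 * \<delta>)) - (- 3 / (1 - x - 2 * \<delta>)))" .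
    have "3 / (1 - 2 * \<delta>) \<le> 3 / (1 - x - 2 * \<delta>)"
      using True \<delta> that by (intro divide_left_mono) auto
    then have "0 \<le> (- 3 / (1 - 2 * \<delta>)) - (- 3 / (1 - x - 2 * \<delta>))" by simp
    moreover have "C1 * gap_cost \<delta> x = 3 / (1 - 2 * \<delta>) + ((- 3 / (1 - 2 * \<delta>)) - (- 3 / (1 - x - 2 * \<delta>)))"
    proof -
      have "C1 * gap_cost \<delta> x = 3 / (1 - 2 * \<delta> - x)"
        using True \<open>0 < C1\<close> by (simp add: gap_cost_def C1_def[symmetric])
      also have "1 - 2 * \<delta> - x = 1 - x - 2 * \<delta>" by simp
      finally show ?thesis by simp
    qed
    ultimately show ?thesis
      unfolding eq using \<delta> by (subst ennreal_plus[symmetric]) auto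
  next
    case False
    then show ?thesis by (simp add: gap_cost_def)
  qed
  have meas: "case_prod f \<in> borel_measurable (\<Gamma> \<Otimes>\<^sub>M lborel)"
  proof -
    have "case_prod f \<in> borel_measurable (borel \<Otimes>\<^sub>M lborel)"
      unfolding f_def by measurable
    then show ?thesis
      using sets_prior by (simp cong: measurable_cong_sets sets_pair_measure_cong)
  qed
  \<comment> \<open>For fixed \<open>y\<close> only means \<open>x \<ge> 1 - y\<close> count, so
    regularity bounds their mass by \<open>C0 * y\<close>; the condition
    \<open>x < 1 - 3 * \<delta>\<close> forces \<open>y > 3 * \<delta>\<close>.\<close>
  have slice: "(\<integral>\<^sup>+x. f x y \<partial>\<Gamma>) \<le> ennreal (C0 * (3 * y / (y - 2 * \<delta>)\<^sup>2)) * indicator {3 * \<delta>..1} y" for y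
  proof (cases "3 * \<delta> \<le> y \<and> y \<le> 1")
    case True
    have "(\<integral>\<^sup>+x. f x y \<partial>\<Gamma>) \<le> (\<integral>\<^sup>+x. ennreal (h y) * indicator {x. x \<ge> 1 - y} x \<partial>\<Gamma>)"
      by (intro nn_integral_mono) (auto simp: f_def indicator_def)
    also have "\<dots> = ennreal (h y) * emeasure \<Gamma> {x. x \<ge> 1 - y}"
      by (intro nn_integral_cmult_indicator) (simp add: sets_prior)
    also have "\<dots> \<le> ennreal (h y) * ennreal (C0 * y)"
      using tail_le[of y] True \<delta>
      by (intro mult_left_mono) (auto simp: prior.emeasure_eq_measure intro!: ennreal_leI)
    also have "\<dots> = ennreal (C0 * (3 * y / (y - 2 * \<delta>)\<^sup>2))"
      using h0 C0_ge_1 True \<delta> by (subst ennreal_mult[symmetric]) (auto simp: h_def)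
    finally show ?thesis using True by simp
  next
    case False
    then have "f x y = 0" for x by (auto simp: f_def)
    then show ?thesis by simp
  qed
  \<comment> \<open>Antiderivative of \<open>C0 * 3 * y / (y - 2 * \<delta>)\<^sup>2\<close>, found
    by writing \<open>y = (y - 2 * \<delta>) + 2 * \<delta>\<close>.\<close>
  define F where "F y = C0 * (3 * ln (y - 2 * \<delta>) - 6 * \<delta> / (y - 2 * \<delta>))" for y
  have "(\<integral>\<^sup>+y. \<integral>\<^sup>+x. f x y \<partial>\<Gamma> \<partial>lborel)
      \<le> (\<integral>\<^sup>+y. ennreal (C0 * (3 * y / (y - 2 * \<delta>)\<^sup>2)) * indicator {3 * \<delta>..1} y \<partial>lborel)"
    by (intro nn_integral_mono slice)
  also have "\<dots> = ennreal (F 1 - F (3 * \<delta>))"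
  proof (rule nn_integral_FTC_Icc)
    fix y assume "y \<in> {3 * \<delta>..1}"
    then have "y - 2 * \<delta> > 0" using \<delta> by auto
    then have "((\<lambda>y. 3 * ln (y - 2 * \<delta>) - 6 * \<delta> / (y - 2 * \<delta>)) has_real_derivative
        3 / (y - 2 * \<delta>) + 6 * \<delta> / (y - 2 * \<delta>)\<^sup>2) (at y)"
      by (auto intro!: derivative_eq_intros simp: power2_eq_square)
    also have "3 / (y - 2 * \<delta>) + 6 * \<delta> / (y - 2 * \<delta>)\<^sup>2 = 3 * y / (y - 2 * \<delta>)\<^sup>2"
    proof -
      define w where "w = y - 2 * \<delta>"
      have "w > 0" "y = w + 2 * \<delta>" using \<open>y - 2 * \<delta> > 0\<close> by (simp_all add: w_def)
      then show ?thesis by (simp add: power2_eq_square field_simps)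
    qed
    finally show "(F has_real_derivative C0 * (3 * y / (y - 2 * \<delta>)\<^sup>2)) (at y)"
      unfolding F_def by (rule DERIV_cmult)
  next
    show "0 \<le> C0 * (3 * y / (y - 2 * \<delta>)\<^sup>2)" if "y \<in> {3 * \<delta>..1}" for y
      using C0_ge_1 that \<delta> by auto
  qed (use \<delta> in auto)
  finally have swap: "(\<integral>\<^sup>+x. \<integral>\<^sup>+y. f x y \<partial>lborel \<partial>\<Gamma>) \<le> ennreal (F 1 - F (3 * \<delta>))"
    by (subst Fubini'[OF meas, symmetric])
  have F: "F 1 - F (3 * \<delta>) = C0 * (3 * ln (1 - 2 * \<delta>) - 6 * \<delta> / (1 - 2 * \<delta>) + 3 * ln (1 / \<delta>) + 6)"
    using \<delta> by (simp add: F_def ln_div algebra_simps)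
  have lnd: "0 \<le> ln (1 / \<delta>)" using \<delta> by simp
  have le: "3 / (1 - 2 * \<delta>) + (F 1 - F (3 * \<delta>)) \<le> C0 * (9 + 3 * ln (1 / \<delta>))"
  proof -
    have "3 / (1 - 2 * \<delta>) \<le> C0 * (3 / (1 - 2 * \<delta>))"
      using mult_right_mono[OF C0_ge_1, of "3 / (1 - 2 * \<delta>)"] \<delta> by simp
    then have "3 / (1 - 2 * \<delta>) + (F 1 - F (3 * \<delta>))
       \<le> C0 * (3 / (1 - 2 * \<delta>) - 6 * \<delta> / (1 - 2 * \<delta>) + 3 * ln (1 - 2 * \<delta>) + 3 * ln (1 / \<delta>) + 6)"
      unfolding F by (simp add: algebra_simps)
    \<comment> \<open>The boundary term and the fraction from \<open>F 1\<close> combine to 3, which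
      with the 6 from \<open>F (3 * \<delta>)\<close> gives the constant 9.\<close>
    also have "3 / (1 - 2 * \<delta>) - 6 * \<delta> / (1 - 2 * \<delta>) = 3"
    proof -
      have "3 / (1 - 2 * \<delta>) - 6 * \<delta> / (1 - 2 * \<delta>) = 3 * (1 - 2 * \<delta>) / (1 - 2 * \<delta>)"
        by (simp only: diff_divide_distrib[symmetric] right_diff_distrib) simp
      also have "\<dots> = 3" using \<delta> by (intro nonzero_mult_div_cancel_right) auto
      finally show ?thesis .
    qed
    also have "C0 * (3 + 3 * ln (1 - 2 * \<delta>) + 3 * ln (1 / \<delta>) + 6) \<le> C0 * (9 + 3 * ln (1 / \<delta>))"
      using C0_ge_1 \<delta> ln_le_zero_iff[of "1 - 2 * \<delta>"] by (intro mult_left_mono) auto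
    finally show ?thesis .
  qed
  have F0: "0 \<le> F 1 - F (3 * \<delta>)"
  proof -
    have "F (3 * \<delta>) \<le> F 1"
      unfolding F_def using C0_ge_1 \<delta>
      by (intro mult_left_mono diff_mono divide_left_mono) auto
    then show ?thesis by simp
  qed
  have "ennreal (C1 * (\<integral>x. gap_cost \<delta> x \<partial>\<Gamma>)) = (\<integral>\<^sup>+x. ennreal (C1 * gap_cost \<delta> x) \<partial>\<Gamma>)"
    using integrable_gap_cost[OF \<delta>(1)] gap_cost_bounds[OF \<delta>(1)] \<open>0 < C1\<close>
    by (subst nn_integral_eq_integral) auto
  also have "\<dots> \<le> (\<integral>\<^sup>+x. ennreal (3 / (1 - 2 * \<delta>)) + (\<integral>\<^sup>+y. f x y \<partial>lborel) \<partial>\<Gamma>)"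
    by (intro nn_integral_mono_AE) (use AE_prior layer in auto)
  also have "\<dots> = ennreal (3 / (1 - 2 * \<delta>)) + (\<integral>\<^sup>+x. \<integral>\<^sup>+y. f x y \<partial>lborel \<partial>\<Gamma>)"
    using meas by (subst nn_integral_add) (auto simp: prior.emeasure_space_1[simplified] intro: lborel.borel_measurable_nn_integral)
  also have "\<dots> \<le> ennreal (3 / (1 - 2 * \<delta>)) + ennreal (F 1 - F (3 * \<delta>))"
    by (intro add_left_mono swap)
  also have "\<dots> = ennreal (3 / (1 - 2 * \<delta>) + (F 1 - F (3 * \<delta>)))"
    using F0 \<delta> by (subst ennreal_plus) auto
  also have "\<dots> \<le> ennreal (C0 * (9 + 3 * ln (1 / \<delta>)))"
    by (intro ennreal_leI le)
  finally have "C1 * (\<integral>x. gap_cost \<delta> x \<partial>\<Gamma>) \<le> C0 * (9 + 3 * ln (1 / \<delta>))"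
    using C0_ge_1 lnd by (subst (asm) ennreal_le_iff) auto
  then show ?thesis
    using \<open>0 < C1\<close> by (simp add: C1_def[symmetric] field_simps)
qed

text \<open>The factor of one arm in the bound on the event that all good arms cross.\<close>

definition survival :: "real \<Rightarrow> real \<Rightarrow> real" where
  "survival \<delta> x = (if x > 1 - \<delta> then exp (- \<delta>\<^sup>2 / 2) else 1)"

lemma survival_bounds: "0 \<le> survival \<delta> x" "survival \<delta> x \<le> 1"
  by (auto simp: survival_def)

lemma measurable_survival [measurable]: "survival \<delta> \<in> borel_measurable borel"
  unfolding survival_def by measurable

lemma integrable_survival: "integrable \<Gamma> (survival \<delta>)"
  by (rule prior.integrable_const_bound[where B = 1])
    (use survival_bounds in \<open>auto simp: measurable_prior\<close>)

text \<open>A good arm has probability at least \<open>c0 * \<delta>\<close> and lowers the factor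
  by at least \<open>(1 - exp (-1)) * \<delta>\<^sup>2 / 2\<close>; this produces the cube of
  \<open>\<delta>\<close>, and \<open>1 + u \<le> exp u\<close> finishes.\<close>

lemma integral_survival_le:
  assumes \<delta>: "0 < \<delta>" "\<delta> \<le> 1"
  shows "(\<integral>x. survival \<delta> x \<partial>\<Gamma>) \<le> exp (- c0 * ((1 - exp (-1)) / 2) * \<delta> ^ 3)"
proof -
  have "\<delta>\<^sup>2 \<le> 1" using \<delta> by (simp add: power_le_one)
  let ?q = "1 - exp (- \<delta>\<^sup>2 / 2)"
  have "(\<integral>x. survival \<delta> x \<partial>\<Gamma>) = (\<integral>x. 1 - ?q * indicator {x. x > 1 - \<delta>} x \<partial>\<Gamma>)"
    by (intro Bochner_Integration.integral_cong) (auto simp: survival_def)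
  also have "\<dots> = 1 - ?q * measure \<Gamma> {x. x > 1 - \<delta>}"
    by (subst Bochner_Integration.integral_diff)
      (auto simp: sets_prior prior.prob_space[simplified] prior.emeasure_eq_measure)
  also have "\<dots> \<le> 1 - ((1 - exp (-1)) * (\<delta>\<^sup>2 / 2)) * (c0 * \<delta>)"
    using one_minus_exp_ge[of "\<delta>\<^sup>2 / 2"] \<open>\<delta>\<^sup>2 \<le> 1\<close> tail_ge[OF \<delta>] c0_pos \<delta>
    by (intro diff_left_mono mult_mono) auto
  also have "\<dots> = 1 + (- c0 * ((1 - exp (-1)) / 2) * \<delta> ^ 3)"
    by (simp add: power2_eq_square power3_eq_cube)
  also have "\<dots> \<le> exp (- c0 * ((1 - exp (-1)) / 2) * \<delta> ^ 3)" by (rule exp_ge_add_one_self)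
  finally show ?thesis .
qed

text \<open>The best mean is at most 1, so comparing with 1 only increases the regret. Means beyond
  index \<open>k\<close> are reset to 0, which meets the locale assumptions at every index without
  changing the reward table.\<close>

lemma regret_le:
  assumes arms: "arms \<noteq> []" "distinct arms" "set arms \<subseteq> {..<k}"
    and \<mu>: "\<And>i. i < k \<Longrightarrow> \<mu> i \<in> {0..1}" and \<delta>: "0 < \<delta>"
  shows "regret P k T (greedy arms) \<mu>
    \<le> real T * (\<Prod>i\<in>set arms. survival \<delta> (\<mu> i)) + 3 * \<delta> * real T + (\<Sum>j\<in>set arms. gap_cost \<delta> (\<mu> j))"
proof -
  define \<mu>' where "\<mu>' i = (if i < k then \<mu> i else 0)" for i
  have \<mu>': "\<mu>' i \<in> {0..1}" for i using \<mu> by (auto simp: \<mu>'_def)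
  have eq: "\<mu>' i = \<mu> i" if "i \<in> set arms" for i using that arms(3) by (auto simp: \<mu>'_def)
  interpret greedy_run "\<lambda>i. P (\<mu>' i)" \<mu>' arms k
  proof (intro greedy_run.intro subgaussian_table.intro greedy_run_axioms.intro)
    show "prob_space (P (\<mu>' i))" "sets (P (\<mu>' i)) = sets borel" for i using fam[OF \<mu>'] by auto
    show "(\<integral>\<^sup>+z. ennreal (exp (s * (z - \<mu>' i))) \<partial>P (\<mu>' i)) \<le> ennreal (exp (s\<^sup>2 / 2))" for i s
      using subg[OF \<mu>', of i] by (subst nn_integral_eq_integral) (auto simp: one_subgaussian_def intro!: ennreal_leI)
  qed (use arms in auto)
  have space: "reward_space P k T \<mu> = table k T"
    unfolding reward_space_def table_def by (intro PiM_cong) (auto simp: \<mu>'_def)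
  have greedy: "\<mu> (greedy arms Y t) = \<mu>' (greedy arms Y t)" for Y t
    using greedy_in_arms[OF arms(1)] eq by simp
  have "k > 0" using arms by (cases arms) auto
  then have "Max (\<mu> ` {..<k}) \<le> 1" using \<mu> by (intro Max.boundedI) auto
  then have "regret P k T (greedy arms) \<mu> \<le> real T - (\<Sum>t<T. \<integral>Y. \<mu>' (greedy arms Y t) \<partial>table k T)"
    unfolding regret_def space greedy using mult_left_mono[of _ 1 "real T"] by simp
  also have "\<dots> \<le> real T * (\<Prod>i\<in>set arms. if \<mu>' i > 1 - \<delta> then exp (- \<delta>\<^sup>2 / 2) else 1) + 3 * \<delta> * real T
      + (\<Sum>j\<in>set arms. gap_cost \<delta> (\<mu>' j))"
    using \<delta> \<mu>' by (intro expected_regret_le) auto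
  finally show ?thesis by (simp add: eq survival_def)
qed

theorem bayes_regret_greedy_le:
  assumes arms: "arms \<noteq> []" "distinct arms" "set arms \<subseteq> {..<k}"
    and \<delta>: "0 < \<delta>" "\<delta> \<le> 1 / 3"
  shows "bayes_regret \<Gamma> P k T (greedy arms)
    \<le> real T * exp (- real (length arms) * c0 * ((1 - exp (-1)) / 2) * \<delta> ^ 3) + 3 * \<delta> * real T
      + real (length arms) * (C0 / ((1 - exp (-1)) / 2) * (9 + 3 * ln (1 / \<delta>)))"
proof -
  define Q where "Q = PiM {..<k} (\<lambda>_. \<Gamma>)"
  interpret product_prob_space "\<lambda>_ :: nat. \<Gamma>" "{..<k}"
    by (intro product_prob_spaceI) (rule prob_prior)
  interpret Q: prob_space Q unfolding Q_def by (rule prob_space_PiM) (rule prob_prior)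
  define U where "U \<mu> = real T * (\<Prod>i\<in>set arms. survival \<delta> (\<mu> i)) + 3 * \<delta> * real T
    + (\<Sum>j\<in>set arms. gap_cost \<delta> (\<mu> j))" for \<mu> :: "nat \<Rightarrow> real"
  \<comment> \<open>Padding with the constant 1 turns the product over \<open>arms\<close> into one
    over all \<open>k\<close> independent coordinates, so that its integral factorises.\<close>
  define g where "g i x = (if i \<in> set arms then survival \<delta> x else 1)" for i x
  have g: "integrable \<Gamma> (g i)" for i
    unfolding g_def using integrable_survival by (cases "i \<in> set arms") auto
  have prod: "(\<Prod>i\<in>set arms. survival \<delta> (\<mu> i)) = (\<Prod>i<k. g i (\<mu> i))" for \<mu>
    unfolding g_def using arms(3) by (intro prod.mono_neutral_cong_left) auto
  have int_prod: "integrable Q (\<lambda>\<mu>. \<Prod>i\<in>set arms. survival \<delta> (\<mu> i))"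
    unfolding prod Q_def by (intro product_integrable_prod g) simp
  have "(\<integral>\<mu>. (\<Prod>i\<in>set arms. survival \<delta> (\<mu> i)) \<partial>Q) = (\<Prod>i<k. \<integral>x. g i x \<partial>\<Gamma>)"
    unfolding prod Q_def by (intro product_integral_prod g) simp
  also have "\<dots> = (\<Prod>i\<in>set arms. \<integral>x. survival \<delta> x \<partial>\<Gamma>)"
    using arms(3) by (intro prod.mono_neutral_cong_right) (auto simp: g_def prior.prob_space[simplified])
  also have "\<dots> \<le> exp (- c0 * ((1 - exp (-1)) / 2) * \<delta> ^ 3) ^ length arms"
    using integral_survival_le[of \<delta>] \<delta> survival_bounds
    by (auto simp: distinct_card[OF arms(2)] intro!: power_mono integral_nonneg_AE)
  also have "\<dots> = exp (- real (length arms) * c0 * ((1 - exp (-1)) / 2) * \<delta> ^ 3)"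
    by (simp add: mult.assoc flip: exp_of_nat_mult)
  finally have bad: "(\<integral>\<mu>. (\<Prod>i\<in>set arms. survival \<delta> (\<mu> i)) \<partial>Q)
      \<le> exp (- real (length arms) * c0 * ((1 - exp (-1)) / 2) * \<delta> ^ 3)" .
  have gap: "integrable Q (\<lambda>\<mu>. gap_cost \<delta> (\<mu> j))"
    "(\<integral>\<mu>. gap_cost \<delta> (\<mu> j) \<partial>Q) = (\<integral>x. gap_cost \<delta> x \<partial>\<Gamma>)" if "j \<in> set arms" for j
  proof -
    have j: "j \<in> {..<k}" using that arms(3) by auto
    have distr: "distr Q \<Gamma> (\<lambda>\<mu>. \<mu> j) = \<Gamma>"
      unfolding Q_def using j by (intro distr_PiM_component prob_prior)
    have comp: "(\<lambda>\<mu>. \<mu> j) \<in> measurable Q \<Gamma>"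
      unfolding Q_def using j by (rule measurable_component_singleton)
    have m: "gap_cost \<delta> \<in> borel_measurable \<Gamma>" by (simp add: measurable_prior)
    show "integrable Q (\<lambda>\<mu>. gap_cost \<delta> (\<mu> j))"
      using integrable_gap_cost[OF \<delta>(1)] integrable_distr_eq[OF comp m] distr by simp
    show "(\<integral>\<mu>. gap_cost \<delta> (\<mu> j) \<partial>Q) = (\<integral>x. gap_cost \<delta> x \<partial>\<Gamma>)"
      using integral_distr[OF comp m] distr by simp
  qed
  have int_U: "integrable Q U"
    unfolding U_def using int_prod gap by auto
  have U0: "0 \<le> U \<mu>" for \<mu>
    unfolding U_def using \<delta> survival_bounds gap_cost_bounds
    by (auto intro!: add_nonneg_nonneg mult_nonneg_nonneg prod_nonneg sum_nonneg)
  have "AE \<mu> in Q. \<forall>i\<in>{..<k}. \<mu> i \<in> {0..1}"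
    unfolding Q_def
    by (intro AE_finite_allI AE_PiM_component prob_prior AE_prior) auto
  then have AE: "AE \<mu> in Q. regret P k T (greedy arms) \<mu> \<le> U \<mu>"
    unfolding U_def by (rule AE_mp) (use regret_le[OF arms _ \<delta>(1)] in auto)
  have "bayes_regret \<Gamma> P k T (greedy arms) \<le> (\<integral>\<mu>. U \<mu> \<partial>Q)"
  \<comment> \<open>Without integrability the Bochner integral defaults to 0, which is still below
    the integral of the nonnegative \<open>U\<close>.\<close>
  proof (cases "integrable Q (regret P k T (greedy arms))")
    case True
    then show ?thesis
      unfolding bayes_regret_def Q_def[symmetric] using AE int_U by (intro integral_mono_AE) auto
  next
    case False
    then show ?thesis
      unfolding bayes_regret_def Q_def[symmetric] using U0 by (simp add: not_integrable_integral_eq)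
  qed
  also have "\<dots> = real T * (\<integral>\<mu>. (\<Prod>i\<in>set arms. survival \<delta> (\<mu> i)) \<partial>Q) + 3 * \<delta> * real T
      + (\<Sum>j\<in>set arms. \<integral>x. gap_cost \<delta> x \<partial>\<Gamma>)"
    unfolding U_def using int_prod gap by (simp add: Q.prob_space)
  also have "\<dots> \<le> real T * exp (- real (length arms) * c0 * ((1 - exp (-1)) / 2) * \<delta> ^ 3) + 3 * \<delta> * real T
      + (\<Sum>j\<in>set arms. C0 / ((1 - exp (-1)) / 2) * (9 + 3 * ln (1 / \<delta>)))"
    using bad integral_gap_cost_le[OF \<delta>] by (intro add_mono mult_left_mono sum_mono order.refl) auto
  finally show ?thesis by (simp add: distinct_card[OF arms(2)])
qed

end


subsection \<open>Tuning the threshold\<close>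

context bayesian_bandit
begin

text \<open>The lower bound on \<open>m\<close> says exactly that \<open>q \<le> 1 / 27\<close>,
  that is \<open>\<delta> \<le> 1 / 3\<close>. As \<open>2 * exp 1 * C1 = exp 1 - 1 \<ge> 1\<close>,
  the choice \<open>\<delta> ^ 3 = q\<close> makes the exponent at most \<open>- ln T\<close>, so
  the crossing event costs at most 1.\<close>

theorem bayes_regret_greedy_tuned_le:
  fixes arms :: "nat list" and T :: nat
  defines "m \<equiv> real (length arms)"
  assumes arms: "distinct arms" "set arms \<subseteq> {..<k}"
    and T: "2 \<le> T" and m: "54 * exp 1 * ln (real T) / c0 \<le> m"
  shows "bayes_regret \<Gamma> P k T (greedy arms)
    \<le> 1 + 3 * real T * (2 * exp 1 * ln (real T) / (m * c0)) powr (1/3)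
        + C0 * m / ((1 - exp (-1)) / 2) * (15 + ln (m * c0 / (2 * exp 1)) - ln (ln (real T)))"
proof -
  define L where "L = ln (real T)"
  define C1 where "C1 = (1 - exp (-1 :: real)) / 2"
  define q where "q = 2 * exp 1 * L / (m * c0)"
  define \<delta> where "\<delta> = q powr (1/3)"
  have "0 < C1" by (simp add: C1_def)
  have "0 < L" using T by (simp add: L_def)
  have "0 < 54 * exp 1 * L / c0" using \<open>0 < L\<close> c0_pos by simp
  also have "\<dots> \<le> m" using m by (simp add: L_def)
  finally have "0 < m" .
  then have "arms \<noteq> []" by (auto simp: m_def)
  have "0 < q" using \<open>0 < L\<close> \<open>0 < m\<close> c0_pos by (simp add: q_def)
  have "54 * exp 1 * L \<le> m * c0" using m c0_pos by (simp add: L_def field_simps)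
  then have "q \<le> 1 / 27" using \<open>0 < m\<close> c0_pos by (simp add: q_def field_simps)
  have "0 < \<delta>" using \<open>0 < q\<close> by (simp add: \<delta>_def)
  have \<delta>3: "\<delta> ^ 3 = q"
    using \<open>0 < q\<close> by (simp add: \<delta>_def powr_powr flip: powr_realpow)
  then have "\<delta> ^ 3 \<le> (1 / 3) ^ 3" using \<open>q \<le> 1 / 27\<close> by (simp add: power_divide)
  then have "\<delta> \<le> 1 / 3" by (rule power_le_imp_le_base[where n = 2, simplified]) simp
  have ln\<delta>: "3 * ln (1 / \<delta>) = ln (m * c0 / (2 * exp 1)) - ln L"
  proof -
    have "3 * ln (1 / \<delta>) = - ln q" using \<open>0 < q\<close> by (simp add: \<delta>_def ln_div ln_powr)
    also have "\<dots> = ln (m * c0 / (2 * exp 1)) - ln L"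
      using \<open>0 < L\<close> \<open>0 < m\<close> c0_pos by (simp add: q_def ln_div ln_mult)
    finally show ?thesis .
  qed
  have bad: "real T * exp (- m * c0 * C1 * \<delta> ^ 3) \<le> 1"
  proof -
    have "- m * c0 * C1 * \<delta> ^ 3 = - ((exp 1 - 1) * L)"
      using \<open>0 < m\<close> c0_pos unfolding \<delta>3 by (simp add: q_def C1_def exp_minus field_simps)
    also have "\<dots> \<le> - (1 * L)"
      using exp_ge_add_one_self[of 1] \<open>0 < L\<close> by (intro le_imp_neg_le mult_right_mono) auto
    finally have "exp (- m * c0 * C1 * \<delta> ^ 3) \<le> exp (- L)" by simp
    also have "\<dots> = 1 / real T" using T by (simp add: L_def exp_minus field_simps)
    finally show ?thesis using T by (simp add: field_simps)
  qed
  have "bayes_regret \<Gamma> P k T (greedy arms)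
    \<le> real T * exp (- m * c0 * C1 * \<delta> ^ 3) + 3 * \<delta> * real T + m * (C0 / C1 * (9 + 3 * ln (1 / \<delta>)))"
    using bayes_regret_greedy_le[OF \<open>arms \<noteq> []\<close> arms \<open>0 < \<delta>\<close> \<open>\<delta> \<le> 1 / 3\<close>] by (simp add: m_def C1_def)
  \<comment> \<open>The constant 9 from the prior average is enlarged to the 15 of the claimed
    bound.\<close>
  also have "\<dots> \<le> 1 + 3 * \<delta> * real T + m * (C0 / C1 * (15 + 3 * ln (1 / \<delta>)))"
    using bad \<open>0 < m\<close> \<open>0 < C1\<close> \<open>0 < \<delta>\<close> C0_ge_1 by (intro add_mono mult_left_mono) auto
  also have "\<dots> = 1 + 3 * real T * \<delta> + C0 * m / C1 * (15 + ln (m * c0 / (2 * exp 1)) - ln L)"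
    unfolding ln\<delta> by (simp add: algebra_simps)
  finally show ?thesis by (simp only: \<delta>_def q_def L_def C1_def)
qed

text \<open>The bound depends on the arms only through their number, so it holds for each subset and
  hence for the average. The condition \<open>m \<le> k\<close> makes the family of subsets
  nonempty.\<close>

lemma ss_greedy_bayes_regret_le:
  assumes "m \<le> k" "2 \<le> T" "54 * exp 1 * ln (real T) / c0 \<le> real m"
  shows "ss_greedy_bayes_regret \<Gamma> P k T m
    \<le> 1 + 3 * real T * (2 * exp 1 * ln (real T) / (real m * c0)) powr (1/3)
        + C0 * real m / ((1 - exp (-1)) / 2) * (15 + ln (real m * c0 / (2 * exp 1)) - ln (ln (real T)))"
    (is "_ \<le> ?B")
proof -
  let ?S = "{S. S \<subseteq> {..<k} \<and> card S = m}"
  have fin: "finite ?S" by simp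
  have "{..<m} \<in> ?S" using assms by auto
  then have ne: "?S \<noteq> {}" by blast
  have "bayes_regret \<Gamma> P k T (greedy (sorted_list_of_set S)) \<le> ?B" if "S \<in> ?S" for S
  proof -
    have S: "finite S" "S \<subseteq> {..<k}" "card S = m" using that finite_subset by auto
    then show ?thesis
      using bayes_regret_greedy_tuned_le[of "sorted_list_of_set S" k T] assms by simp
  qed
  then have "(\<Sum>S\<in>?S. bayes_regret \<Gamma> P k T (greedy (sorted_list_of_set S))) \<le> real (card ?S) * ?B"
    by (rule sum_bounded_above)
  moreover have "0 < card ?S" using fin ne by (simp add: card_gt_0_iff)
  ultimately show ?thesis
    unfolding ss_greedy_bayes_regret_def integral_pmf_of_set[OF ne fin]
    by (simp add: divide_le_eq mult.commute)
qed

text \<open>The choice of \<open>m\<close> balances the two main terms: up to logarithms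
  \<open>T / m powr (1/3)\<close> and \<open>m\<close> are both of order
  \<open>T powr (3/4)\<close>. The constants are chosen before \<open>k\<close>, so the bound is
  uniform in it.\<close>

lemma ss_greedy_rate:
  fixes m :: "nat \<Rightarrow> nat"
  assumes "(\<lambda>T. real (m T)) \<in> \<Theta>(\<lambda>T. real T powr (3/4))"
  shows "\<exists>C T0. \<forall>T k. T \<ge> T0 \<and> k \<ge> m T \<longrightarrow>
           ss_greedy_bayes_regret \<Gamma> P k T (m T) \<le> C * real T powr (3/4) * ln (real T)"
proof -
  obtain a where a: "a > 0" "\<forall>\<^sub>F T in at_top. a * norm (real T powr (3/4)) \<le> norm (real (m T))"
    using bigthetaD2[OF assms] by (auto elim: landau_omega.bigE)
  obtain A where A: "A > 0" "\<forall>\<^sub>F T in at_top. norm (real (m T)) \<le> A * norm (real T powr (3/4))"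
    using bigthetaD1[OF assms] by (auto elim: landau_o.bigE)
  \<comment> \<open>A power of \<open>T\<close> outgrows its logarithm, so the size condition of the
    tuned bound holds from some horizon on.\<close>
  have "\<forall>\<^sub>F T :: nat in at_top. 54 * exp 1 * ln (real T) / c0 \<le> a * real T powr (3/4)"
    using a(1) c0_pos by real_asymp
  with a(2) A(2) have "\<forall>\<^sub>F T in at_top. a * real T powr (3/4) \<le> real (m T)
      \<and> real (m T) \<le> A * real T powr (3/4) \<and> 54 * exp 1 * ln (real T) / c0 \<le> a * real T powr (3/4) \<and> 3 \<le> T"
    using eventually_ge_at_top[of "3 :: nat"] by eventually_elim simp
  then obtain T0 where T0: "\<And>T. T \<ge> T0 \<Longrightarrow> a * real T powr (3/4) \<le> real (m T)
      \<and> real (m T) \<le> A * real T powr (3/4) \<and> 54 * exp 1 * ln (real T) / c0 \<le> a * real T powr (3/4) \<and> 3 \<le> T"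
    unfolding eventually_at_top_linorder by blast
  define K where "K = (2 * exp 1 / (a * c0)) powr (1/3)"
  define C1 where "C1 = (1 - exp (-1 :: real)) / 2"
  \<comment> \<open>The absolute value is taken because this logarithm may have either sign.\<close>
  define b where "b = \<bar>ln (A * c0 / (2 * exp 1))\<bar>"
  have "0 < C1" by (simp add: C1_def)
  have "ss_greedy_bayes_regret \<Gamma> P k T (m T)
      \<le> (1 + 3 * K + C0 * A / C1 * (16 + b)) * real T powr (3/4) * ln (real T)"
    if T: "T \<ge> T0" and k: "k \<ge> m T" for T k
  proof -
    define x where "x = real T powr (3/4)"
    define L where "L = ln (real T)"
    define M where "M = real (m T)"
    have M: "a * x \<le> M" "M \<le> A * x" "54 * exp 1 * L / c0 \<le> a * x" and "3 \<le> T"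
      using T0[OF T] by (auto simp: x_def L_def M_def)
    \<comment> \<open>\<open>T \<ge> 3\<close> gives \<open>L \<ge> 1\<close>, so that one factor
      \<open>L\<close> absorbs constants and the smaller power of \<open>L\<close>.\<close>
    have "exp 1 \<le> real T" using exp_le \<open>3 \<le> T\<close> by linarith
    then have L: "1 \<le> L" using \<open>3 \<le> T\<close> by (simp add: L_def ln_ge_iff)
    have x: "1 \<le> x" using \<open>3 \<le> T\<close> by (simp add: x_def ge_one_powr_ge_zero)
    have "0 < a * x" using a x by simp
    then have "0 < M" using M by simp
    have "2 * exp 1 * L / (M * c0) \<le> 2 * exp 1 * L / ((a * x) * c0)"
      using M \<open>0 < a * x\<close> \<open>0 < M\<close> c0_pos L by (intro divide_left_mono mult_right_mono) auto
    also have "\<dots> = (2 * exp 1 / (a * c0)) * L / x" by simp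
    finally have "(2 * exp 1 * L / (M * c0)) powr (1/3) \<le> ((2 * exp 1 / (a * c0)) * L / x) powr (1/3)"
      using \<open>0 < M\<close> c0_pos L by (intro powr_mono2) auto
    also have "\<dots> = K * L powr (1/3) / x powr (1/3)"
      using a c0_pos L x by (simp add: K_def powr_mult powr_divide)
    also have "\<dots> \<le> K * L / x powr (1/3)"
      using L x powr_mono[of "1/3" 1 L] by (intro divide_right_mono mult_left_mono) (auto simp: K_def)
    finally have "real T * (2 * exp 1 * L / (M * c0)) powr (1/3) \<le> real T * (K * L / x powr (1/3))"
      by (intro mult_left_mono) auto
    also have "\<dots> = K * x * L"
    proof -
      have "x powr (1/3) * x = real T"
        using \<open>3 \<le> T\<close> by (simp add: x_def powr_powr flip: powr_add)
      then have "real T / x powr (1/3) = x" using x by (simp add: field_simps)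
      moreover have "real T * (K * L / x powr (1/3)) = K * L * (real T / x powr (1/3))" by simp
      ultimately show ?thesis by (simp only: mult_ac)
    qed
    finally have t1: "real T * (2 * exp 1 * L / (M * c0)) powr (1/3) \<le> K * x * L" .
    have "ln (M * c0 / (2 * exp 1)) \<le> ln (A * x * c0 / (2 * exp 1))"
      using M \<open>0 < M\<close> c0_pos by (intro ln_mono divide_right_mono mult_right_mono) auto
    also have "\<dots> = ln (A * c0 / (2 * exp 1) * x)" by (simp add: mult_ac)
    also have "\<dots> = ln (A * c0 / (2 * exp 1)) + 3 / 4 * L"
      using A(1) c0_pos x \<open>3 \<le> T\<close> by (subst ln_mult) (auto simp: x_def L_def ln_powr)
    also have "\<dots> \<le> b + L" using L by (simp add: b_def)
    finally have "15 + ln (M * c0 / (2 * exp 1)) - ln L \<le> 15 + (b + L)"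
      using ln_ge_zero[OF L] by linarith
    also have "\<dots> \<le> 15 * L + (b * L + L)"
      using L mult_left_mono[of 1 L b] by (simp add: b_def)
    finally have t2: "15 + ln (M * c0 / (2 * exp 1)) - ln L \<le> (16 + b) * L" by (simp add: algebra_simps)
    have "C0 * M / C1 * (15 + ln (M * c0 / (2 * exp 1)) - ln L) \<le> C0 * M / C1 * ((16 + b) * L)"
      using t2 \<open>0 < M\<close> \<open>0 < C1\<close> C0_ge_1 by (intro mult_left_mono) auto
    also have "\<dots> \<le> C0 * (A * x) / C1 * ((16 + b) * L)"
      using M \<open>0 < C1\<close> C0_ge_1 L by (intro mult_right_mono divide_right_mono mult_left_mono) (auto simp: b_def)
    finally have t3: "C0 * M / C1 * (15 + ln (M * c0 / (2 * exp 1)) - ln L) \<le> C0 * A / C1 * (16 + b) * x * L"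
      by (simp add: mult_ac)
    have t0: "1 \<le> x * L" using x L mult_mono[of 1 x 1 L] by simp
    have "ss_greedy_bayes_regret \<Gamma> P k T (m T)
      \<le> 1 + 3 * real T * (2 * exp 1 * L / (M * c0)) powr (1/3)
          + C0 * M / C1 * (15 + ln (M * c0 / (2 * exp 1)) - ln L)"
      using ss_greedy_bayes_regret_le[OF k, of T] M \<open>3 \<le> T\<close> by (simp add: L_def M_def C1_def)
    also have "\<dots> \<le> x * L + 3 * (K * x * L) + C0 * A / C1 * (16 + b) * x * L"
      using t0 t1 t3 by simp
    also have "\<dots> = (1 + 3 * K + C0 * A / C1 * (16 + b)) * x * L" by (simp add: algebra_simps)
    finally show ?thesis by (simp add: x_def L_def)
  qed
  then show ?thesis by blast
qed

end

theorem theorem6: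
  fixes \<Gamma> :: "real measure" and P :: "real \<Rightarrow> real measure" and c0 C0 :: real
  assumes prior: "prob_space \<Gamma>" "sets \<Gamma> = sets borel" "measure \<Gamma> {0..1} = 1"
    and prior_density: "absolutely_continuous lborel \<Gamma>"
    and constants: "0 < c0" "c0 < C0"
    and regular: "one_regular \<Gamma> c0 C0"
    and fam_meas: "P \<in> borel \<rightarrow>\<^sub>M subprob_algebra borel"
    and fam: "\<And>\<mu>. \<mu> \<in> {0..1} \<Longrightarrow> prob_space (P \<mu>) \<and> sets (P \<mu>) = sets borel
                 \<and> integrable (P \<mu>) (\<lambda>z. z) \<and> (\<integral>z. z \<partial>P \<mu>) = \<mu>"
    and subg: "\<And>\<mu>. \<mu> \<in> {0..1} \<Longrightarrow> one_subgaussian (P \<mu>) \<mu>"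
  shows "(\<forall>T k::nat. 2 \<le> T \<and> real k \<ge> 54 * exp 1 * ln (real T) / c0 \<longrightarrow>
            bayes_regret \<Gamma> P k T (greedy [0..<k])
              \<le> 1 + 3 * real T * (2 * exp 1 * ln (real T) / (real k * c0)) powr (1/3)
                  + C0 * real k / ((1 - exp (-1)) / 2)
                    * (15 + ln (real k * c0 / (2 * exp 1)) - ln (ln (real T))))
       \<and> (\<forall>m :: nat \<Rightarrow> nat. (\<lambda>T. real (m T)) \<in> \<Theta>(\<lambda>T. real T powr (3/4)) \<longrightarrow>
            (\<exists>(C::real) (p::nat) (T0::nat). \<forall>T k. T \<ge> T0 \<and> k \<ge> m T \<longrightarrow>
               ss_greedy_bayes_regret \<Gamma> P k T (m T) \<le> C * real T powr (3/4) * ln (real T) ^ p))"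
proof -
  interpret bayesian_bandit \<Gamma> P c0 C0
    by (rule bayesian_bandit.intro) (use prior constants regular fam subg in auto)
  show ?thesis
  proof (intro conjI allI impI)
    fix T k :: nat
    assume "2 \<le> T \<and> real k \<ge> 54 * exp 1 * ln (real T) / c0"
    then show "bayes_regret \<Gamma> P k T (greedy [0..<k])
              \<le> 1 + 3 * real T * (2 * exp 1 * ln (real T) / (real k * c0)) powr (1/3)
                  + C0 * real k / ((1 - exp (-1)) / 2)
                    * (15 + ln (real k * c0 / (2 * exp 1)) - ln (ln (real T)))"
      using bayes_regret_greedy_tuned_le[of "[0..<k]" k T] by (simp add: atLeast0LessThan)
  next
    fix m :: "nat \<Rightarrow> nat"
    assume "(\<lambda>T. real (m T)) \<in> \<Theta>(\<lambda>T. real T powr (3/4))"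
    \<comment> \<open>A single logarithmic factor suffices, so the witness is
      \<open>p = 1\<close>.\<close>
    from ss_greedy_rate[OF this] obtain C T0 where
      "\<forall>T k. T \<ge> T0 \<and> k \<ge> m T \<longrightarrow>
         ss_greedy_bayes_regret \<Gamma> P k T (m T) \<le> C * real T powr (3/4) * ln (real T) ^ 1"
      by auto
    then show "\<exists>(C::real) (p::nat) (T0::nat). \<forall>T k. T \<ge> T0 \<and> k \<ge> m T \<longrightarrow>
        ss_greedy_bayes_regret \<Gamma> P k T (m T) \<le> C * real T powr (3/4) * ln (real T) ^ p"
      by blast
  qed
qed

end
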